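(* Computing an optimal policy for a maxPPS, and computing an optimal policy for a minPPS, are PosSLP-hard: PosSLP is polynomial-time reducible to each of these problems.
   Context: A probabilistic polynomial in $x=(x_1,\dots,x_n)$ is $\sum_{r}p_r x^{\alpha_r}$ with rational $p_r\ge0$, $\sum_r p_r\le1$. A maxPPS (resp. minPPS) is a system $x_i=P_i(x)$, $i=1,\dots,n$, where each $P_i(x)=\max\{q_{i,1}(x),\dots,q_{i,m_i}(x)\}$ (resp. $\min$) for probabilistic polynomials $q_{i,j}$. It has a least fixed point (LFP) $q^*\in[0,1]^n$. A policy is a map $\sigma$ with $1\le\sigma(i)\le m_i$; $P_\sigma$ is the polynomial system with $(P_\sigma)_i=q_{i,\sigma(i)}$ and $q^*_\sigma$ its LFP. A policy $\sigma$ is optimal for a maxPPS if $q^*_\sigma\ge q^*_{\sigma'}$ for all policies $\sigma'$, and optimal for a minPPS if $q^*_\sigma\le q^*_{\sigma'}$ for all $\sigma'$. PosSLP is the decision problem: given an arithmetic circuit (straight-line program) with gates $+,-,\times$ and the constant input $1$, decide whether the integer it computes is positive. *)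

theory Defs
  imports Complex_Main "HOL-Computational_Algebra.Polynomial"
begin

section \<open>Polynomial-time computability\<close>

datatype letter = Zero | One | Open | Close

type_synonym word = "letter list"

text \<open>
  Deterministic Turing machines with finitely many two-way infinite tapes. The tape alphabet is
  \<open>{0..<symbols M}\<close> with blank symbol \<open>0\<close>; the non-halting states are \<open>{0..<states M}\<close>, the initial
  state is \<open>0\<close>, and every state \<open>\<ge> states M\<close> is halting.
  The first tape is the input tape and the second one the output tape.
\<close>

datatype direction = MoveLeft | Stay | MoveRight

record TM =
  tapes :: nat
  symbols :: nat
  states :: nat
  delta :: "nat \<Rightarrow> nat list \<Rightarrow> nat \<times> (nat \<times> direction) list"

fun letter_symbol :: "letter \<Rightarrow> nat" where
  "letter_symbol Zero = 1"
| "letter_symbol One = 2"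
| "letter_symbol Open = 3"
| "letter_symbol Close = 4"

definition wf_TM :: "TM \<Rightarrow> bool" where
  "wf_TM M \<longleftrightarrow> tapes M \<ge> 2 \<and> symbols M \<ge> 5 \<and>
    (\<forall>q rs. q < states M \<and> length rs = tapes M \<and> set rs \<subseteq> {..<symbols M} \<longrightarrow>
      (case delta M q rs of (q', as) \<Rightarrow>
        q' \<le> states M \<and> length as = tapes M \<and> fst ` set as \<subseteq> {..<symbols M}))"

text \<open>A tape is given by its head position and its contents.\<close>

type_synonym tape = "int \<times> (int \<Rightarrow> nat)"

type_synonym config = "nat \<times> tape list"

fun offset :: "direction \<Rightarrow> int" where
  "offset MoveLeft = -1"
| "offset Stay = 0"
| "offset MoveRight = 1"

fun read_tape :: "tape \<Rightarrow> nat" where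
  "read_tape (h, c) = c h"

fun act_tape :: "nat \<times> direction \<Rightarrow> tape \<Rightarrow> tape" where
  "act_tape (s, d) (h, c) = (h + offset d, c(h := s))"

fun step :: "TM \<Rightarrow> config \<Rightarrow> config" where
  "step M (q, ts) =
    (if q < states M
     then (case delta M q (map read_tape ts) of (q', as) \<Rightarrow> (q', map2 act_tape as ts))
     else (q, ts))"

definition word_contents :: "word \<Rightarrow> int \<Rightarrow> nat" where
  "word_contents w = (\<lambda>i. if 0 \<le> i \<and> i < int (length w) then letter_symbol (w ! nat i) else 0)"

definition init_config :: "TM \<Rightarrow> word \<Rightarrow> config" where
  "init_config M w = (0, (0, word_contents w) # replicate (tapes M - 1) (0, \<lambda>_. 0))"

text \<open>Since \<open>step\<close> leaves halting configurations unchanged, this says that the machine halts after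
  at most \<open>t\<close> steps.\<close>

definition computes_within :: "TM \<Rightarrow> nat \<Rightarrow> word \<Rightarrow> word \<Rightarrow> bool" where
  "computes_within M t w v \<longleftrightarrow>
    (case (step M ^^ t) (init_config M w) of (q, ts) \<Rightarrow>
      q \<ge> states M \<and> snd (ts ! 1) = word_contents v)"

text \<open>The function \<open>f\<close> on the set \<open>D\<close> is polynomial-time computable with respect to the encodings
  \<open>encA\<close> of its arguments and \<open>encB\<close> of its values.\<close>

definition polytime_on :: "'a set \<Rightarrow> ('a \<Rightarrow> word) \<Rightarrow> ('b \<Rightarrow> word) \<Rightarrow> ('a \<Rightarrow> 'b) \<Rightarrow> bool" where
  "polytime_on D encA encB f \<longleftrightarrow>
    (\<exists>M (p :: nat poly). wf_TM M \<and>
      (\<forall>x\<in>D. computes_within M (poly p (length (encA x))) (encA x) (encB (f x))))"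


section \<open>Encodings\<close>

definition bracket :: "word \<Rightarrow> word" where
  "bracket w = Open # w @ [Close]"

text \<open>Binary notation, least significant bit first; the number \<open>0\<close> has no bits.\<close>

fun bits :: "nat \<Rightarrow> word" where
  "bits n = (if n = 0 then [] else (if odd n then One else Zero) # bits (n div 2))"

declare bits.simps [simp del]

definition enc_nat :: "nat \<Rightarrow> word" where
  "enc_nat n = bracket (bits n)"

definition enc_bool :: "bool \<Rightarrow> word" where
  "enc_bool b = (if b then [One] else [Zero])"

definition enc_list :: "('a \<Rightarrow> word) \<Rightarrow> 'a list \<Rightarrow> word" where
  "enc_list e xs = bracket (concat (map e xs))"

fun enc_pair :: "('a \<Rightarrow> word) \<Rightarrow> ('b \<Rightarrow> word) \<Rightarrow> 'a \<times> 'b \<Rightarrow> word" where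
  "enc_pair e e' (a, b) = bracket (e a @ e' b)"

text \<open>Only used for nonnegative rationals: numerator and denominator in lowest terms.\<close>

definition enc_rat :: "rat \<Rightarrow> word" where
  "enc_rat r = (case quotient_of r of (a, b) \<Rightarrow> enc_pair enc_nat enc_nat (nat a, nat b))"


section \<open>Decision problems, search problems and reductions\<close>

record 'i decision_problem =
  dec_instances :: "'i set"
  dec_enc :: "'i \<Rightarrow> word"
  dec_yes :: "'i \<Rightarrow> bool"

record ('i, 's) search_problem =
  srch_instances :: "'i set"
  srch_enc :: "'i \<Rightarrow> word"
  srch_solution :: "'i \<Rightarrow> 's \<Rightarrow> bool"
  srch_enc_sol :: "'s \<Rightarrow> word"

text \<open>
  Polynomial-time reduction of a decision problem to a search problem: an instance \<open>x\<close> is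
  transformed in polynomial time into a (solvable) instance \<open>f x\<close> of the search problem such that
  the answer for \<open>x\<close> can be read off, in polynomial time, from \<open>x\<close> and any solution of \<open>f x\<close>.
\<close>

definition polytime_reducible :: "'i decision_problem \<Rightarrow> ('j, 's) search_problem \<Rightarrow> bool" where
  "polytime_reducible D S \<longleftrightarrow>
    (\<exists>f g.
      polytime_on (dec_instances D) (dec_enc D) (srch_enc S) f \<and>
      polytime_on {(x, y). x \<in> dec_instances D \<and> srch_solution S (f x) y}
        (enc_pair (dec_enc D) (srch_enc_sol S)) enc_bool g \<and>
      (\<forall>x \<in> dec_instances D.
        f x \<in> srch_instances S \<and>
        (\<exists>y. srch_solution S (f x) y) \<and>
        (\<forall>y. srch_solution S (f x) y \<longrightarrow> (g (x, y) \<longleftrightarrow> dec_yes D x))))"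


section \<open>PosSLP\<close>

text \<open>The arguments of a gate are the positions (counted from \<open>0\<close>) of earlier gates; the last gate
  is the output gate.\<close>

datatype gate = Const1 | Add nat nat | Sub nat nat | Mul nat nat

type_synonym slp = "gate list"

fun gate_args :: "gate \<Rightarrow> nat set" where
  "gate_args Const1 = {}"
| "gate_args (Add i j) = {i, j}"
| "gate_args (Sub i j) = {i, j}"
| "gate_args (Mul i j) = {i, j}"

definition wf_slp :: "slp \<Rightarrow> bool" where
  "wf_slp c \<longleftrightarrow> c \<noteq> [] \<and> (\<forall>k < length c. gate_args (c ! k) \<subseteq> {..<k})"

fun gate_value :: "int list \<Rightarrow> gate \<Rightarrow> int" where
  "gate_value vs Const1 = 1"
| "gate_value vs (Add i j) = vs ! i + vs ! j"
| "gate_value vs (Sub i j) = vs ! i - vs ! j"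
| "gate_value vs (Mul i j) = vs ! i * vs ! j"

definition slp_values :: "slp \<Rightarrow> int list" where
  "slp_values c = foldl (\<lambda>vs g. vs @ [gate_value vs g]) [] c"

definition slp_output :: "slp \<Rightarrow> int" where
  "slp_output c = last (slp_values c)"

fun enc_gate :: "gate \<Rightarrow> word" where
  "enc_gate Const1 = bracket [Zero, Zero]"
| "enc_gate (Add i j) = bracket ([Zero, One] @ enc_nat i @ enc_nat j)"
| "enc_gate (Sub i j) = bracket ([One, Zero] @ enc_nat i @ enc_nat j)"
| "enc_gate (Mul i j) = bracket ([One, One] @ enc_nat i @ enc_nat j)"

definition PosSLP :: "slp decision_problem" where
  "PosSLP = \<lparr>dec_instances = {c. wf_slp c}, dec_enc = enc_list enc_gate,
    dec_yes = (\<lambda>c. slp_output c > 0)\<rparr>"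


section \<open>Probabilistic polynomial systems with maximum or minimum\<close>

text \<open>
  Variables are numbered from \<open>0\<close>. A monomial \<open>x\<^sup>\<alpha>\<close> is represented sparsely by the pairs
  \<open>(i, \<alpha>\<^sub>i)\<close> with \<open>\<alpha>\<^sub>i \<noteq> 0\<close>, and a polynomial by its terms \<open>(p\<^sub>r, \<alpha>\<^sub>r)\<close>.
\<close>

type_synonym monomial = "(nat \<times> nat) list"

type_synonym polynomial = "(rat \<times> monomial) list"

definition wf_monomial :: "nat \<Rightarrow> monomial \<Rightarrow> bool" where
  "wf_monomial n m \<longleftrightarrow> distinct (map fst m) \<and> (\<forall>(i, e) \<in> set m. i < n \<and> e > 0)"

definition prob_polynomial :: "nat \<Rightarrow> polynomial \<Rightarrow> bool" where
  "prob_polynomial n q \<longleftrightarrow>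
    (\<forall>(p, m) \<in> set q. p \<ge> 0 \<and> wf_monomial n m) \<and> sum_list (map fst q) \<le> 1"

definition eval_monomial :: "monomial \<Rightarrow> real list \<Rightarrow> real" where
  "eval_monomial m x = (\<Prod>(i, e)\<leftarrow>m. (x ! i) ^ e)"

definition eval_polynomial :: "polynomial \<Rightarrow> real list \<Rightarrow> real" where
  "eval_polynomial q x = (\<Sum>(p, m)\<leftarrow>q. of_rat p * eval_monomial m x)"

text \<open>
  The common data of a maxPPS and of a minPPS in \<open>n = length S\<close> variables: \<open>S ! i\<close> is the list of
  the polynomials \<open>q\<^sub>i\<^sub>,\<^sub>1, \<dots>, q\<^sub>i\<^sub>,\<^sub>m\<close> (with \<open>m = m\<^sub>i\<close>) whose maximum or minimum is \<open>P\<^sub>i\<close>. Whether \<open>S\<close> is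
  read as a maxPPS or as a minPPS affects neither the policies nor the systems \<open>P\<^sub>\<sigma>\<close>, only which
  policies are optimal.
\<close>

type_synonym opt_system = "polynomial list list"

definition wf_opt_system :: "opt_system \<Rightarrow> bool" where
  "wf_opt_system S \<longleftrightarrow> S \<noteq> [] \<and>
    (\<forall>qs \<in> set S. qs \<noteq> [] \<and> (\<forall>q \<in> set qs. prob_polynomial (length S) q))"

text \<open>A policy is given by the positions (counted from \<open>0\<close>) of the chosen polynomials.\<close>

type_synonym policy = "nat list"

definition is_policy :: "opt_system \<Rightarrow> policy \<Rightarrow> bool" where
  "is_policy S \<sigma> \<longleftrightarrow> length \<sigma> = length S \<and> (\<forall>i < length S. \<sigma> ! i < length (S ! i))"

definition policy_system :: "opt_system \<Rightarrow> policy \<Rightarrow> polynomial list" where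
  "policy_system S \<sigma> = map2 (!) S \<sigma>"

definition eval_system :: "polynomial list \<Rightarrow> real list \<Rightarrow> real list" where
  "eval_system P x = map (\<lambda>q. eval_polynomial q x) P"

definition unit_cube :: "nat \<Rightarrow> real list set" where
  "unit_cube n = {x. length x = n \<and> set x \<subseteq> {0..1}}"

abbreviation vec_le :: "real list \<Rightarrow> real list \<Rightarrow> bool" where
  "vec_le \<equiv> list_all2 (\<le>)"

definition is_LFP :: "polynomial list \<Rightarrow> real list \<Rightarrow> bool" where
  "is_LFP P x \<longleftrightarrow> x \<in> unit_cube (length P) \<and> eval_system P x = x \<and>
    (\<forall>y \<in> unit_cube (length P). eval_system P y = y \<longrightarrow> vec_le x y)"

definition LFP :: "polynomial list \<Rightarrow> real list" where
  "LFP P = (THE x. is_LFP P x)"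

definition optimal_max :: "opt_system \<Rightarrow> policy \<Rightarrow> bool" where
  "optimal_max S \<sigma> \<longleftrightarrow> is_policy S \<sigma> \<and>
    (\<forall>\<sigma>'. is_policy S \<sigma>' \<longrightarrow> vec_le (LFP (policy_system S \<sigma>')) (LFP (policy_system S \<sigma>)))"

definition optimal_min :: "opt_system \<Rightarrow> policy \<Rightarrow> bool" where
  "optimal_min S \<sigma> \<longleftrightarrow> is_policy S \<sigma> \<and>
    (\<forall>\<sigma>'. is_policy S \<sigma>' \<longrightarrow> vec_le (LFP (policy_system S \<sigma>)) (LFP (policy_system S \<sigma>')))"

definition enc_opt_system :: "opt_system \<Rightarrow> word" where
  "enc_opt_system =
    enc_list (enc_list (enc_list (enc_pair enc_rat (enc_list (enc_pair enc_nat enc_nat)))))"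

definition OptPolicy_maxPPS :: "(opt_system, policy) search_problem" where
  "OptPolicy_maxPPS = \<lparr>srch_instances = {S. wf_opt_system S}, srch_enc = enc_opt_system,
    srch_solution = optimal_max, srch_enc_sol = enc_list enc_nat\<rparr>"

definition OptPolicy_minPPS :: "(opt_system, policy) search_problem" where
  "OptPolicy_minPPS = \<lparr>srch_instances = {S. wf_opt_system S}, srch_enc = enc_opt_system,
    srch_solution = optimal_min, srch_enc_sol = enc_list enc_nat\<rparr>"


text \<open>The least fixed point exists, so the definite description above is meaningful.\<close>

lemma unit_cube_nth:
  assumes "x \<in> unit_cube n" "i < n"
  shows "0 \<le> x ! i" "x ! i \<le> 1"
proof -
  have "x ! i \<in> set x" "set x \<subseteq> {0..1}"
    using assms by (simp_all add: unit_cube_def)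
  then have "x ! i \<in> {0..1}" by blast
  then show "0 \<le> x ! i" "x ! i \<le> 1" by simp_all
qed

lemma eval_monomial_mono:
  assumes "wf_monomial n m" "x \<in> unit_cube n" "y \<in> unit_cube n" "vec_le x y"
  shows "0 \<le> eval_monomial m x \<and> eval_monomial m x \<le> eval_monomial m y \<and> eval_monomial m y \<le> 1"
  using assms(1)
proof (induction m)
  case Nil
  then show ?case by (simp add: eval_monomial_def)
next
  case (Cons a m)
  obtain i e where a: "a = (i, e)" by force
  have wf: "wf_monomial n m" and i: "i < n"
    using Cons.prems by (auto simp: wf_monomial_def a)
  have xi: "0 \<le> x ! i" and yi: "y ! i \<le> 1" and xy: "x ! i \<le> y ! i"
    using i assms(2-4) unit_cube_nth[of x n i] unit_cube_nth[of y n i]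
    by (auto simp: unit_cube_def list_all2_conv_all_nth)
  have p: "0 \<le> (x ! i) ^ e" "(x ! i) ^ e \<le> (y ! i) ^ e" "(y ! i) ^ e \<le> 1"
    using xi yi xy by (auto intro: power_mono power_le_one)
  note IH = Cons.IH[OF wf]
  have "(x ! i) ^ e * eval_monomial m x \<le> (y ! i) ^ e * eval_monomial m y"
    using p IH by (intro mult_mono) auto
  moreover have "(y ! i) ^ e * eval_monomial m y \<le> 1"
    using p IH by (intro mult_le_one) auto
  moreover have "0 \<le> (x ! i) ^ e * eval_monomial m x"
    using p IH by simp
  ultimately show ?case by (simp add: a eval_monomial_def)
qed

lemma eval_polynomial_mono:
  assumes "prob_polynomial n q" "x \<in> unit_cube n" "y \<in> unit_cube n" "vec_le x y"
  shows "0 \<le> eval_polynomial q x \<and> eval_polynomial q x \<le> eval_polynomial q y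
    \<and> eval_polynomial q y \<le> 1"
proof -
  have "\<forall>(p, m) \<in> set q. p \<ge> 0 \<and> wf_monomial n m"
    using assms(1) by (simp add: prob_polynomial_def)
  then have "0 \<le> eval_polynomial q x \<and> eval_polynomial q x \<le> eval_polynomial q y
    \<and> eval_polynomial q y \<le> of_rat (sum_list (map fst q))"
  proof (induction q)
    case Nil
    then show ?case by (simp add: eval_polynomial_def)
  next
    case (Cons a q)
    obtain p m where a: "a = (p, m)" by force
    have p: "(0::real) \<le> of_rat p" and m: "wf_monomial n m"
      using Cons.prems by (auto simp: a)
    note mm = eval_monomial_mono[OF m assms(2-4)]
    have "of_rat p * eval_monomial m x \<le> of_rat p * eval_monomial m y"
      using mm p by (intro mult_left_mono) auto
    moreover have "of_rat p * eval_monomial m y \<le> of_rat p"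
      using mm p by (intro mult_left_le) auto
    moreover have "0 \<le> of_rat p * eval_monomial m x"
      using mm p by simp
    ultimately show ?case
      using Cons by (auto simp: a eval_polynomial_def of_rat_add)
  qed
  moreover have "(of_rat (sum_list (map fst q)) :: real) \<le> 1"
    using assms(1) by (simp add: prob_polynomial_def)
  ultimately show ?thesis by linarith
qed

lemma LFP_exists:
  assumes "\<forall>q \<in> set P. prob_polynomial (length P) q"
  shows "\<exists>!x. is_LFP P x"
proof -
  define n where "n = length P"
  define A where "A = {y \<in> unit_cube n. vec_le (eval_system P y) y}"
  define x where "x = map (\<lambda>i. Inf ((\<lambda>y. y ! i) ` A)) [0..<n]"
  have pp: "prob_polynomial n q" if "q \<in> set P" for q
    using assms that by (simp add: n_def)
  have refl: "vec_le z z" for z by (simp add: list_all2_conv_all_nth)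
  have cube: "eval_system P z \<in> unit_cube n" if "z \<in> unit_cube n" for z
    using eval_polynomial_mono[OF pp that that refl]
    by (auto simp: unit_cube_def eval_system_def n_def)
  have mono: "vec_le (eval_system P z) (eval_system P w)"
    if "z \<in> unit_cube n" "w \<in> unit_cube n" "vec_le z w" for z w
    using eval_polynomial_mono[OF pp that]
    by (auto simp: eval_system_def list_all2_conv_all_nth)
  have "replicate n 1 \<in> A"
  proof -
    have c: "replicate n 1 \<in> unit_cube n" by (auto simp: unit_cube_def)
    have "vec_le (eval_system P (replicate n 1)) (replicate n 1)"
      using unit_cube_nth[OF cube[OF c]]
      by (auto simp: list_all2_conv_all_nth eval_system_def n_def)
    with c show ?thesis by (simp add: A_def)
  qed
  then have ne: "A \<noteq> {}" by blast
  have coord: "0 \<le> y ! i \<and> y ! i \<le> 1" if "y \<in> A" "i < n" for y i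
    using that unit_cube_nth[of y n i] by (simp add: A_def)
  have bdd: "bdd_below ((\<lambda>y. y ! i) ` A)" if "i < n" for i
    using coord that by (intro bdd_belowI[of _ 0]) auto
  have xn: "length x = n" by (simp add: x_def)
  have low: "vec_le x y" if "y \<in> A" for y
  proof -
    have "length y = n" using that by (simp add: A_def unit_cube_def)
    moreover have "x ! i \<le> y ! i" if "i < n" for i
      using cInf_lower[OF _ bdd[OF that], of "y ! i"] \<open>y \<in> A\<close> that by (simp add: x_def)
    ultimately show ?thesis by (simp add: list_all2_conv_all_nth xn)
  qed
  have great: "vec_le z x" if "length z = n" "\<And>y. y \<in> A \<Longrightarrow> vec_le z y" for z
  proof -
    have "z ! i \<le> x ! i" if "i < n" for i
    proof -
      have "z ! i \<le> Inf ((\<lambda>y. y ! i) ` A)"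
      proof (rule cInf_greatest)
        show "(\<lambda>y. y ! i) ` A \<noteq> {}" using ne by simp
      next
        fix v assume "v \<in> (\<lambda>y. y ! i) ` A"
        then obtain y where y: "y \<in> A" "v = y ! i" by blast
        show "z ! i \<le> v"
          using \<open>\<And>y. y \<in> A \<Longrightarrow> vec_le z y\<close>[OF y(1)] \<open>length z = n\<close> \<open>i < n\<close> y(2)
          by (simp add: list_all2_conv_all_nth)
      qed
      then show ?thesis using that by (simp add: x_def)
    qed
    then show ?thesis using that(1) by (simp add: list_all2_conv_all_nth xn)
  qed
  have xc: "x \<in> unit_cube n"
  proof -
    have "vec_le (replicate n 0) x"
      using coord by (intro great) (auto simp: list_all2_conv_all_nth A_def unit_cube_def)
    moreover have "vec_le x (replicate n 1)" using low \<open>replicate n 1 \<in> A\<close> by blast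
    ultimately show ?thesis
      by (auto simp: unit_cube_def list_all2_conv_all_nth in_set_conv_nth xn)
  qed
  have pre: "vec_le (eval_system P x) x"
  proof (rule great)
    show "length (eval_system P x) = n" by (simp add: eval_system_def n_def)
  next
    fix y assume y: "y \<in> A"
    have "vec_le (eval_system P x) (eval_system P y)"
      using y by (intro mono xc low) (auto simp: A_def)
    moreover have "vec_le (eval_system P y) y" using y by (simp add: A_def)
    ultimately show "vec_le (eval_system P x) y"
      by (rule list_all2_trans[rotated]) auto
  qed
  have "eval_system P x \<in> A"
    using mono[OF cube[OF xc] xc pre] cube[OF xc] by (simp add: A_def)
  then have post: "vec_le x (eval_system P x)" by (rule low)
  have asym: "z = w" if "vec_le z w" "vec_le w z" for z w
    using that by (auto simp: list_all2_conv_all_nth intro!: nth_equalityI order_antisym)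
  have "is_LFP P x"
    using xc asym[OF pre post] low refl by (auto simp: is_LFP_def A_def simp flip: n_def)
  then show ?thesis
    using asym unfolding is_LFP_def by blast
qed

end

theory Submission
  imports Defs
begin

text \<open>
  The value of a gate is kept as a formal fraction \<open>(a - b) / s\<close> of probabilities. A gate computes
  its own \<open>a\<close>, \<open>b\<close>, \<open>s\<close> from those of its arguments like a common fraction, with products
  only: a sum or a difference has the denominator \<open>s\<^sub>i s\<^sub>j\<close> up to a constant factor that keeps
  the coefficients small. Hence no common scaling of the gates is needed, and every polynomial
  refers to the variables of the two arguments only. The output is positive iff \<open>2 * a > 2 * b + s\<close>;
  equality never occurs as the value is an integer, so that an optimal policy for a variable
  choosing between both sides has to reveal the answer.

  The numbering of the variables is such that the binary notation of an index is a constant word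
  followed by the binary notation of a gate. A machine can thus write the system without
  arithmetic, by copying pieces of its input into constant text.
\<close>

section \<open>Two-way transducers\<close>

datatype instr = Emit letter | GoLeft | GoRight | Copy
  | SeekLeft letter | SeekRight "letter option" | Case "letter option \<Rightarrow> nat"

text \<open>The states of a transducer are the suffixes of the pieces of its program; the empty suffix is
  the halting state. \<open>Case\<close> discards the rest of the current piece.\<close>

type_synonym program = "instr list list"

definition code :: "program \<Rightarrow> nat \<Rightarrow> instr list" where
  "code P l = (if l < length P then P ! l else [])"

fun symbol_letter :: "nat \<Rightarrow> letter option" where
  "symbol_letter s = (if s = 1 then Some Zero else if s = 2 then Some One
     else if s = 3 then Some Open else if s = 4 then Some Close else None)"

lemma symbol_letter_inverse [simp]: "symbol_letter (letter_symbol a) = Some a"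
  by (cases a) auto

lemma symbol_letter_0 [simp]: "symbol_letter 0 = None"
  by simp

declare symbol_letter.simps [simp del]

text \<open>The result consists of the next state, the move of the input head and the letter
  appended to the output. \<open>Copy\<close>, \<open>SeekLeft\<close> and \<open>SeekRight\<close>
  stay in their state while they loop.\<close>

fun act :: "program \<Rightarrow> letter option \<Rightarrow> instr list \<Rightarrow> instr list \<times> direction \<times> letter option" where
  "act P a [] = ([], Stay, None)"
| "act P a (Emit b # is) = (is, Stay, Some b)"
| "act P a (GoLeft # is) = (is, MoveLeft, None)"
| "act P a (GoRight # is) = (is, MoveRight, None)"
| "act P a (Copy # is) =
    (if a = Some Zero \<or> a = Some One then (Copy # is, MoveRight, a) else (is, Stay, None))"
| "act P a (SeekLeft b # is) =
    (if a = Some b then (is, Stay, None) else (SeekLeft b # is, MoveLeft, None))"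
| "act P a (SeekRight b # is) =
    (if a = b then (is, Stay, None) else (SeekRight b # is, MoveRight, None))"
| "act P a (Case f # is) = (code P (f a), Stay, None)"

section \<open>Simulation of a transducer by a Turing machine\<close>

definition states_list :: "program \<Rightarrow> instr list list" where
  "states_list P = concat (map (\<lambda>is. map (\<lambda>i. drop i is) [0..<length is]) P)"

text \<open>A suffix that occurs in several pieces is one state, hence the least index. The number
  of the empty suffix equals the number of non-halting states of \<open>program_TM P\<close>, so it
  halts.\<close>

definition state_number :: "program \<Rightarrow> instr list \<Rightarrow> nat" where
  "state_number P is = (if is = [] then length (states_list P)
     else LEAST i. i < length (states_list P) \<and> states_list P ! i = is)"

text \<open>The input symbol is always written back, so the input word survives. The output head
  advances exactly when a letter is emitted, and thus always stands directly behind the word written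
  so far.\<close>

definition program_TM :: "program \<Rightarrow> TM" where
  "program_TM P = \<lparr>tapes = 2, symbols = 5, states = length (states_list P),
    delta = (\<lambda>q rs. case act P (symbol_letter (rs ! 0)) (states_list P ! q) of (is, d, u) \<Rightarrow>
      (state_number P is,
       [(rs ! 0, d), (case u of None \<Rightarrow> (rs ! 1, Stay) | Some a \<Rightarrow> (letter_symbol a, MoveRight))]))\<rparr>"

lemma set_states_list: "is \<in> set (states_list P) \<longleftrightarrow> is \<noteq> [] \<and> (\<exists>ks. ks @ is \<in> set P)"
proof
  assume "is \<in> set (states_list P)"
  then obtain js i where "js \<in> set P" "i < length js" "is = drop i js"
    by (auto simp: states_list_def)
  then show "is \<noteq> [] \<and> (\<exists>ks. ks @ is \<in> set P)"
    by (auto intro!: exI[of _ "take i js"])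
next
  assume *: "is \<noteq> [] \<and> (\<exists>ks. ks @ is \<in> set P)"
  then obtain ks where ks: "ks @ is \<in> set P" by blast
  have "is = drop (length ks) (ks @ is)" "length ks < length (ks @ is)"
    using * by auto
  then show "is \<in> set (states_list P)"
    using ks unfolding states_list_def set_concat set_map image_image
    by (intro UN_I[of "ks @ is"] image_eqI[of _ _ "length ks"]) simp_all
qed

lemma state_number:
  assumes "is \<in> set (states_list P)"
  shows "state_number P is < length (states_list P)"
    and "states_list P ! state_number P is = is"
proof -
  have "is \<noteq> []" using assms by (simp add: set_states_list)
  moreover obtain i where "i < length (states_list P) \<and> states_list P ! i = is"
    using assms by (auto simp: in_set_conv_nth)
  ultimately have "state_number P is < length (states_list P) \<and> states_list P ! state_number P is = is"
    unfolding state_number_def by (simp only: if_False) (rule LeastI)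
  then show "state_number P is < length (states_list P)"
    "states_list P ! state_number P is = is" by simp_all
qed

lemma state_number_le: "is \<in> set (states_list P) \<or> is = [] \<Longrightarrow> state_number P is \<le> length (states_list P)"
  using state_number(1)[of "is" P] by (auto simp: state_number_def)

lemma code_in_states: "code P l \<in> set (states_list P) \<or> code P l = []"
  by (auto simp: code_def set_states_list intro!: exI[of _ "[]"])

lemma act_closed:
  assumes "is \<in> set (states_list P)" "act P a is = (is', d, u)"
  shows "is' \<in> set (states_list P) \<or> is' = []"
proof -
  obtain i js ks where i: "is = i # js" and "ks @ i # js \<in> set P"
    using assms(1) by (auto simp: set_states_list neq_Nil_conv)
  then have js: "js \<in> set (states_list P) \<or> js = []"
    unfolding set_states_list by (auto intro!: exI[of _ "ks @ [i]"])
  show ?thesis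
    using assms js code_in_states[of P] unfolding i
    by (cases i) (auto split: if_splits)
qed

lemma wf_program_TM: "wf_TM (program_TM P)"
proof -
  have *: "case delta (program_TM P) q rs of (q', as) \<Rightarrow>
      q' \<le> length (states_list P) \<and> length as = 2 \<and> fst ` set as \<subseteq> {..<5}"
    if q: "q < length (states_list P)" and rs: "length rs = 2" "set rs \<subseteq> {..<5}" for q rs
  proof -
    obtain "is" d u where u: "act P (symbol_letter (rs ! 0)) (states_list P ! q) = (is, d, u)"
      by (metis prod_cases3)
    have "state_number P is \<le> length (states_list P)"
      using act_closed[OF _ u] q state_number_le by simp
    moreover have "rs ! 0 < 5" "rs ! 1 < 5"
      using rs nth_mem[of 0 rs] nth_mem[of 1 rs] by fastforce+
    moreover have "letter_symbol a < 5" for a by (cases a) auto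
    ultimately show ?thesis
      by (auto simp: program_TM_def u split: option.splits)
  qed
  show ?thesis
    unfolding wf_TM_def using * by (auto simp: program_TM_def)
qed

text \<open>The input word is \<open>rev l @ r\<close>, with the head on the first letter of \<open>r\<close>.\<close>

type_synonym state = "instr list \<times> word \<times> word \<times> word"

definition read :: "word \<Rightarrow> letter option" where
  "read r = (case r of [] \<Rightarrow> None | a # _ \<Rightarrow> Some a)"

lemma read_simps [simp]: "read [] = None" "read (a # r) = Some a"
  by (simp_all add: read_def)

fun config_of :: "program \<Rightarrow> state \<Rightarrow> config" where
  "config_of P (is, l, r, out) = (state_number P is,
     [(int (length l), word_contents (rev l @ r)), (int (length out), word_contents out)])"

text \<open>As \<open>stop\<close> allows any \<open>n\<close>, the number is only an upper bound
  for the steps. No rule moves left from an empty left part or right from an empty right part, so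
  the head stays on the input or on the first blank behind it.\<close>

inductive run :: "program \<Rightarrow> nat \<Rightarrow> state \<Rightarrow> state \<Rightarrow> bool" for P where
  stop: "run P n s s"
| emit: "run P n (is, l, r, out @ [a]) s \<Longrightarrow> run P (Suc n) (Emit a # is, l, r, out) s"
| left: "run P n (is, l, a # r, out) s \<Longrightarrow> run P (Suc n) (GoLeft # is, a # l, r, out) s"
| right: "run P n (is, a # l, r, out) s \<Longrightarrow> run P (Suc n) (GoRight # is, l, a # r, out) s"
| copy: "a = Zero \<or> a = One \<Longrightarrow> run P n (Copy # is, a # l, r, out @ [a]) s \<Longrightarrow>
    run P (Suc n) (Copy # is, l, a # r, out) s"
| copy_end: "read r \<noteq> Some Zero \<Longrightarrow> read r \<noteq> Some One \<Longrightarrow> run P n (is, l, r, out) s \<Longrightarrow>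
    run P (Suc n) (Copy # is, l, r, out) s"
| seek_left: "read r \<noteq> Some b \<Longrightarrow> run P n (SeekLeft b # is, l, a # r, out) s \<Longrightarrow>
    run P (Suc n) (SeekLeft b # is, a # l, r, out) s"
| seek_left_end: "read r = Some b \<Longrightarrow> run P n (is, l, r, out) s \<Longrightarrow>
    run P (Suc n) (SeekLeft b # is, l, r, out) s"
| seek_right: "Some a \<noteq> b \<Longrightarrow> run P n (SeekRight b # is, a # l, r, out) s \<Longrightarrow>
    run P (Suc n) (SeekRight b # is, l, a # r, out) s"
| seek_right_end: "read r = b \<Longrightarrow> run P n (is, l, r, out) s \<Longrightarrow>
    run P (Suc n) (SeekRight b # is, l, r, out) s"
| branch: "run P n (code P (f (read r)), l, r, out) s \<Longrightarrow>
    run P (Suc n) (Case f # is, l, r, out) s"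

lemma run_add: "run P m s s' \<Longrightarrow> run P (m + k) s s'"
proof (induction m s s' rule: run.induct)
  case (stop n s)
  show ?case by (rule run.stop)
qed (simp only: add_Suc, blast intro: run.intros)+

lemma run_mono: "run P m s s' \<Longrightarrow> m \<le> n \<Longrightarrow> run P n s s'"
  by (metis run_add le_add_diff_inverse)

lemma run_trans: "run P m s s' \<Longrightarrow> run P n s' s'' \<Longrightarrow> run P (m + n) s s''"
proof (induction m s s' rule: run.induct)
  case (stop m s)
  then show ?case by (metis run_add add.commute)
qed (simp only: add_Suc, blast intro: run.intros)+

section \<open>Execution of runs by the machine\<close>

lemma symbol_letter_word_contents:
  "symbol_letter (word_contents (rev l @ r) (int (length l))) = read r"
  by (cases r) (auto simp: word_contents_def nth_append)

lemma word_contents_snoc: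
  "(word_contents out)(int (length out) := letter_symbol a) = word_contents (out @ [a])"
  by (rule ext) (auto simp: word_contents_def nth_append)

text \<open>The input word does not change, so a step amounts to splitting it anew at the moved
  head. In this form one statement fits all instructions.\<close>

lemma step_program_TM:
  assumes "is \<in> set (states_list P)" and "act P (read r) is = (is', d, u)"
    and "length l' = nat (int (length l) + offset d)" "int (length l) + offset d \<ge> 0"
    and "rev l' @ r' = rev l @ r"
  shows "step (program_TM P) (config_of P (is, l, r, out)) =
    config_of P (is', l', r', case u of None \<Rightarrow> out | Some a \<Rightarrow> out @ [a])"
  using assms state_number[OF assms(1)]
  by (auto simp: program_TM_def symbol_letter_word_contents word_contents_snoc split: option.splits)

lemma step_run:
  assumes "run P n s s'" "fst s \<in> set (states_list P) \<or> fst s = []"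
  shows "\<exists>m\<le>n. (step (program_TM P) ^^ m) (config_of P s) = config_of P s'"
proof -
  \<comment> \<open>One machine step followed by the induction hypothesis; every rule of
    \<open>run\<close> except \<open>stop\<close> is an instance of this.\<close>
  have next_step: "\<exists>m\<le>Suc n. (step (program_TM P) ^^ m) (config_of P (is, l, r, out)) = config_of P s'"
    if IH: "fst (is', l', r', out') \<in> set (states_list P) \<or> fst (is', l', r', out') = [] \<Longrightarrow>
        \<exists>m\<le>n. (step (program_TM P) ^^ m) (config_of P (is', l', r', out')) = config_of P s'"
      and is_in: "fst (is, l, r, out) \<in> set (states_list P) \<or> fst (is, l, r, out) = []" "is \<noteq> []"
      and a: "act P (read r) is = (is', d, u)"
      and l: "length l' = nat (int (length l) + offset d)" "int (length l) + offset d \<ge> 0"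
      and r: "rev l' @ r' = rev l @ r" and out: "out' = (case u of None \<Rightarrow> out | Some a \<Rightarrow> out @ [a])"
    for n s' and "is" is' and l l' r r' out out' and d u
  proof -
    have is_in: "is \<in> set (states_list P)" using is_in by auto
    obtain m where "m \<le> n" "(step (program_TM P) ^^ m) (config_of P (is', l', r', out')) = config_of P s'"
      using IH act_closed[OF is_in a] by auto
    then have "(step (program_TM P) ^^ Suc m) (config_of P (is, l, r, out)) = config_of P s'"
      using step_program_TM[OF is_in a l r, of out] out by (simp add: funpow_swap1 del: config_of.simps)
    with \<open>m \<le> n\<close> show ?thesis by (intro exI[of _ "Suc m"]) auto
  qed
  show ?thesis using assms
  proof (induction n s s' rule: run.induct)
    case (stop n s)
    then show ?case by (intro exI[of _ 0]) auto
  next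
    case emit
    show ?case
      by (rule next_step[OF emit.IH emit.prems], (simp add: emit)+)
  next
    case left
    show ?case
      by (rule next_step[OF left.IH left.prems], (simp add: left)+)
  next
    case right
    show ?case
      by (rule next_step[OF right.IH right.prems], (simp add: right)+)
  next
    case copy
    show ?case
      by (rule next_step[OF copy.IH copy.prems], (simp add: copy)+)
  next
    case copy_end
    show ?case
      by (rule next_step[OF copy_end.IH copy_end.prems], (simp add: copy_end)+)
  next
    case seek_left
    show ?case
      by (rule next_step[OF seek_left.IH seek_left.prems], (simp add: seek_left)+)
  next
    case seek_left_end
    show ?case
      by (rule next_step[OF seek_left_end.IH seek_left_end.prems], (simp add: seek_left_end)+)
  next
    case seek_right
    show ?case
      by (rule next_step[OF seek_right.IH seek_right.prems], (simp add: seek_right)+)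
  next
    case seek_right_end
    show ?case
      by (rule next_step[OF seek_right_end.IH seek_right_end.prems], (simp add: seek_right_end)+)
  next
    case branch
    show ?case
      by (rule next_step[OF branch.IH branch.prems], (simp add: branch)+)
  qed
qed

lemma funpow_fixpoint: "f x = x \<Longrightarrow> (f ^^ n) x = x"
  by (induction n) auto

lemma computes_within_program:
  assumes "run P n (code P 0, [], w, []) ([], l, r, v)" "code P 0 \<noteq> []"
  shows "computes_within (program_TM P) n w v"
proof -
  let ?M = "program_TM P"
  obtain is0 P' where P: "P = is0 # P'" "is0 \<noteq> []"
    using assms(2) by (cases P) (auto simp: code_def)
  have c0: "code P 0 \<in> set (states_list P)"
    using code_in_states assms(2) by blast
  \<comment> \<open>The suffixes of the first piece come first, beginning with the whole piece, so
    the run starts in the initial state.\<close>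
  have "states_list P ! 0 = code P 0"
    using P by (cases is0) (auto simp: states_list_def code_def nth_append upt_conv_Cons simp del: upt_Suc)
  then have "state_number P (code P 0) = 0"
    using assms(2) c0 by (auto simp: state_number_def in_set_conv_nth intro!: Least_equality)
  then have init: "init_config ?M w = config_of P (code P 0, [], w, [])"
    by (auto simp: init_config_def program_TM_def word_contents_def numeral_2_eq_2)
  obtain m where m: "m \<le> n" "(step ?M ^^ m) (init_config ?M w) = config_of P ([], l, r, v)"
    using step_run[OF assms(1)] c0 unfolding init by auto
  have halted: "step ?M (config_of P ([], l, r, v)) = config_of P ([], l, r, v)"
    by (simp add: state_number_def program_TM_def)
  \<comment> \<open>The machine may halt early; the halting configuration absorbs the remaining
    \<open>n - m\<close> steps.\<close>
  have "(step ?M ^^ n) (init_config ?M w) = (step ?M ^^ (n - m)) ((step ?M ^^ m) (init_config ?M w))"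
    using m(1) by (metis comp_apply funpow_add le_add_diff_inverse2)
  also have "\<dots> = config_of P ([], l, r, v)"
    unfolding m(2) using halted by (rule funpow_fixpoint)
  finally show ?thesis
    by (simp add: computes_within_def state_number_def program_TM_def)
qed

lemma polytime_on_program:
  assumes "code P 0 \<noteq> []"
    and "\<And>x. x \<in> D \<Longrightarrow> \<exists>l r. run P (poly p (length (encA x))) (code P 0, [], encA x, []) ([], l, r, encB (f x))"
  shows "polytime_on D encA encB f"
  unfolding polytime_on_def using assms computes_within_program wf_program_TM by metis

section \<open>The system of a straight-line program\<close>

text \<open>
  Gate \<open>k\<close> occupies the variables \<open>16 * k + t\<close> with \<open>t < 16\<close>. Its value is
  \<open>(a - b) / s\<close>, where \<open>a\<close>, \<open>b\<close>, \<open>s\<close> are the variables with \<open>t = 8, 9, 10\<close>; those with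
  \<open>t = 11, 12, 13\<close> are copies of them, so that the two factors of a monomial are distinct variables
  even if both arguments of a gate coincide. The variable with \<open>t = 15\<close> compares \<open>2 * a\<close> with
  \<open>2 * b + s\<close>. All others are \<open>0\<close>: they make the bits of \<open>16 * k + t\<close> start with the four bits of
  \<open>t \<ge> 8\<close>, followed by those of \<open>k\<close>, even for \<open>k = 0\<close>.
\<close>

definition block :: "'a list \<Rightarrow> 'a list \<Rightarrow> 'a list \<Rightarrow> 'a list list list" where
  "block A B S = replicate 8 [[]] @ [[A], [B], [S], [A], [B], [S], [[]], [A @ A, B @ B @ S]]"

text \<open>The pairs of tags spell the arithmetic of fractions \<open>(a - b) / s\<close>. A sum
  has \<open>a_i s_j + s_i a_j\<close> and \<open>b_i s_j + s_i b_j\<close> over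
  \<open>s_i s_j\<close>; a difference exchanges \<open>a_j\<close> and \<open>b_j\<close>; a
  product has \<open>a_i a_j + b_i b_j\<close> and \<open>a_i b_j + b_i a_j\<close>. The second tag
  always denotes a copy.\<close>

definition add_block :: "(nat \<times> nat) list list list" where
  "add_block = block [(8, 13), (10, 11)] [(9, 13), (10, 12)] [(10, 13)]"

definition sub_block :: "(nat \<times> nat) list list list" where
  "sub_block = block [(8, 13), (10, 12)] [(9, 13), (10, 11)] [(10, 13)]"

definition mul_block :: "(nat \<times> nat) list list list" where
  "mul_block = block [(8, 11), (9, 12)] [(8, 12), (9, 11)] [(10, 13)]"

text \<open>A common coefficient in all terms cancels in \<open>(a - b) / s\<close>; 1/8 is small
  enough for the up to five terms of \<open>B @ B @ S\<close>.\<close>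

fun gate_term :: "nat \<Rightarrow> nat \<Rightarrow> nat \<times> nat \<Rightarrow> rat \<times> monomial" where
  "gate_term i j (t, t') = (1/8, [(16 * i + t, 1), (16 * j + t', 1)])"

fun gate_block :: "gate \<Rightarrow> polynomial list list" where
  "gate_block Const1 = block [(1/8, [])] [] [(1/8, [])]"
| "gate_block (Add i j) = map (map (map (gate_term i j))) add_block"
| "gate_block (Sub i j) = map (map (map (gate_term i j))) sub_block"
| "gate_block (Mul i j) = map (map (map (gate_term i j))) mul_block"

definition slp_system :: "slp \<Rightarrow> opt_system" where
  "slp_system c = concat (map gate_block c)"

section \<open>Well-formedness of the system\<close>

lemma map_block: "map (map (map h)) (block A B S) = block (map h A) (map h B) (map h S)"
  by (simp add: block_def)

lemma length_block [simp]: "length (block A B S) = 16"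
  by (simp add: block_def)

lemma nth_block:
  assumes "t < 16"
  shows "block A B S ! t = (if t = 8 \<or> t = 11 then [A] else if t = 9 \<or> t = 12 then [B]
    else if t = 10 \<or> t = 13 then [S] else if t = 15 then [A @ A, B @ B @ S] else [[]])"
proof -
  have "t \<in> {0, 1, 2, 3, 4, 5, 6, 7, 8, 9, 10, 11, 12, 13, 14, 15}"
    using assms by (simp only: insert_iff empty_iff) presburger
  then show ?thesis by (elim insertE emptyE) (simp_all add: block_def nth_append)
qed

lemma gate_block_eq_block: "\<exists>A B S. gate_block g = block A B S"
  by (cases g) (auto simp: add_block_def sub_block_def mul_block_def map_block)

lemma length_gate_block [simp]: "length (gate_block g) = 16"
  using gate_block_eq_block[of g] by auto

lemma length_nth_gate_block: "t < 16 \<Longrightarrow> length (gate_block g ! t) = (if t = 15 then 2 else 1)"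
  using gate_block_eq_block[of g] by (auto simp: nth_block)

lemma length_slp_system [simp]: "length (slp_system c) = 16 * length c"
  by (induction c) (simp_all add: slp_system_def)

lemma nth_slp_system:
  "k < length c \<Longrightarrow> t < 16 \<Longrightarrow> slp_system c ! (16 * k + t) = gate_block (c ! k) ! t"
proof (induction c arbitrary: k)
  case Nil
  then show ?case by simp
next
  case (Cons g c)
  then show ?case by (cases k) (simp_all add: slp_system_def nth_append)
qed

lemma prob_polynomial_eighths:
  assumes "\<And>p m. (p, m) \<in> set q \<Longrightarrow> p = 1/8 \<and> wf_monomial n m" "length q \<le> 8"
  shows "prob_polynomial n q"
proof -
  have "sum_list (map fst q) = of_nat (length q) / 8"
    using assms(1)
  proof (induction q)
    case (Cons a q)
    have "fst a = 1/8" using Cons.prems[of "fst a" "snd a"] by simp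
    moreover have "sum_list (map fst q) = of_nat (length q) / 8"
      using Cons.prems by (intro Cons.IH) auto
    ultimately show ?case by (simp add: field_simps)
  qed simp
  moreover have "(of_nat (length q) :: rat) \<le> of_nat 8"
    using assms(2) by (simp only: of_nat_le_iff)
  moreover have "p \<ge> 0 \<and> wf_monomial n m" if "(p, m) \<in> set q" for p m
    using assms(1)[OF that] by simp
  ultimately show ?thesis
    by (auto simp: prob_polynomial_def)
qed

text \<open>The ranges of \<open>t\<close> and \<open>t'\<close> are disjoint, so the two variables
  differ even for \<open>i = j\<close>. Both ranges lie below 15, so no polynomial reads a choice
  variable. The empty monomial comes from \<open>Const1\<close>.\<close>

definition product_below :: "nat \<Rightarrow> monomial \<Rightarrow> bool" where
  "product_below n m \<longleftrightarrow> m = [] \<or> (\<exists>i j t t'. m = [(16 * i + t, 1), (16 * j + t', 1)] \<and>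
    i < n \<and> j < n \<and> t < 11 \<and> 11 \<le> t' \<and> t' < 14)"

lemma fst_gate_term: "fst (gate_term i j r) = 1/8"
  by (cases r) simp

lemma product_below_gate_term:
  "i < n \<Longrightarrow> j < n \<Longrightarrow> t < 11 \<Longrightarrow> 11 \<le> t' \<Longrightarrow> t' < 14 \<Longrightarrow> product_below n (snd (gate_term i j (t, t')))"
  by (auto simp: product_below_def)

text \<open>Collects what the four kinds of gates have in common, so that the bounds on the
  coefficients and the dependence on earlier gates are derived only once.\<close>

lemma gate_block_parts:
  assumes "gate_args g \<subseteq> {..<n}"
  obtains A B S where "gate_block g = block A B S" "length A \<le> 2" "length B \<le> 2" "length S \<le> 1"
    "\<And>r. r \<in> set A \<union> set B \<union> set S \<Longrightarrow> fst r = 1/8 \<and> product_below n (snd r)"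
proof -
  have "\<exists>A B S. gate_block g = block A B S \<and> length A \<le> 2 \<and> length B \<le> 2 \<and> length S \<le> 1 \<and>
      (\<forall>r \<in> set A \<union> set B \<union> set S. fst r = 1/8 \<and> product_below n (snd r))"
  proof (cases g)
    case Const1
    show ?thesis unfolding Const1 gate_block.simps
      by (intro exI conjI, rule refl) (auto simp: product_below_def)
  next
    case (Add i j)
    then have "i < n" "j < n" using assms by auto
    then have "product_below n (snd (gate_term i j (t, t')))" if "t < 11" "11 \<le> t'" "t' < 14" for t t'
      using product_below_gate_term that by blast
    note this [simp]
    show ?thesis unfolding Add gate_block.simps add_block_def map_block
      by (intro exI conjI, rule refl) (auto simp: fst_gate_term simp del: gate_term.simps)
  next
    case (Sub i j)
    then have "i < n" "j < n" using assms by auto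
    then have "product_below n (snd (gate_term i j (t, t')))" if "t < 11" "11 \<le> t'" "t' < 14" for t t'
      using product_below_gate_term that by blast
    note this [simp]
    show ?thesis unfolding Sub gate_block.simps sub_block_def map_block
      by (intro exI conjI, rule refl) (auto simp: fst_gate_term simp del: gate_term.simps)
  next
    case (Mul i j)
    then have "i < n" "j < n" using assms by auto
    then have "product_below n (snd (gate_term i j (t, t')))" if "t < 11" "11 \<le> t'" "t' < 14" for t t'
      using product_below_gate_term that by blast
    note this [simp]
    show ?thesis unfolding Mul gate_block.simps mul_block_def map_block
      by (intro exI conjI, rule refl) (auto simp: fst_gate_term simp del: gate_term.simps)
  qed
  then show thesis using that by blast
qed

lemma polynomial_of_gate_block:
  assumes "gate_args g \<subseteq> {..<n}" "qs \<in> set (gate_block g)" "q \<in> set qs"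
  shows "length q \<le> 8" "r \<in> set q \<Longrightarrow> fst r = 1/8 \<and> product_below n (snd r)"
proof -
  obtain A B S where g: "gate_block g = block A B S"
    and len: "length A \<le> 2" "length B \<le> 2" "length S \<le> 1"
    and terms: "\<And>r. r \<in> set A \<union> set B \<union> set S \<Longrightarrow> fst r = 1/8 \<and> product_below n (snd r)"
    using gate_block_parts[OF assms(1)] by blast
  have q: "q = [] \<or> q = A \<or> q = B \<or> q = S \<or> q = A @ A \<or> q = B @ B @ S"
    using assms(2,3) unfolding g by (auto simp: block_def)
  show "length q \<le> 8" using q len by auto
  have "set q \<subseteq> set A \<union> set B \<union> set S" using q by auto
  then show "r \<in> set q \<Longrightarrow> fst r = 1/8 \<and> product_below n (snd r)" using terms by blast
qed

lemma wf_monomial_product_below: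
  assumes "product_below n m"
  shows "wf_monomial (16 * n) m"
proof -
  have "16 * i + t \<noteq> 16 * j + t'" if "t < 11" "11 \<le> t'" "t' < 14" for i j t t' :: nat
    using that by presburger
  then show ?thesis using assms by (auto simp: wf_monomial_def product_below_def)
qed

lemma prob_polynomial_gate_block:
  assumes "gate_args g \<subseteq> {..<n}" "qs \<in> set (gate_block g)" "q \<in> set qs"
  shows "prob_polynomial (16 * n) q"
proof (rule prob_polynomial_eighths)
  show "p = 1/8 \<and> wf_monomial (16 * n) m" if "(p, m) \<in> set q" for p m
    using polynomial_of_gate_block(2)[OF assms that] wf_monomial_product_below by simp
qed (rule polynomial_of_gate_block(1)[OF assms])

lemma gate_args_less:
  assumes "wf_slp c" "k < length c"
  shows "gate_args (c ! k) \<subseteq> {..<k}" "gate_args (c ! k) \<subseteq> {..<length c}"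
  using assms unfolding wf_slp_def by (blast, fastforce)

lemma wf_slp_system:
  assumes "wf_slp c"
  shows "wf_opt_system (slp_system c)"
proof -
  have "qs \<noteq> [] \<and> (\<forall>q\<in>set qs. prob_polynomial (16 * length c) q)"
    if qs: "qs \<in> set (slp_system c)" for qs
  proof -
    obtain g where "g \<in> set c" "qs \<in> set (gate_block g)"
      using qs by (auto simp: slp_system_def)
    then obtain k where k: "k < length c" "qs \<in> set (gate_block (c ! k))"
      by (auto simp: in_set_conv_nth)
    obtain t where "t < 16" "qs = gate_block (c ! k) ! t"
      using k(2) by (auto simp: in_set_conv_nth)
    then have "length qs > 0"
      by (simp add: length_nth_gate_block)
    then show ?thesis
      using prob_polynomial_gate_block[OF gate_args_less(2)[OF assms k(1)] k(2)] by auto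
  qed
  moreover have "slp_system c \<noteq> []"
    using assms length_slp_system[of c] by (auto simp: wf_slp_def simp del: length_slp_system)
  ultimately show ?thesis by (simp add: wf_opt_system_def)
qed

section \<open>The values of a straight-line program as a recursion\<close>

lemma foldl_snoc_gate_value:
  "\<exists>ws. foldl (\<lambda>vs g. vs @ [gate_value vs g]) us c = us @ ws \<and> length ws = length c"
proof (induction c arbitrary: us)
  case (Cons g c)
  obtain ws where "foldl (\<lambda>vs g. vs @ [gate_value vs g]) (us @ [gate_value us g]) c =
      (us @ [gate_value us g]) @ ws" "length ws = length c"
    using Cons by blast
  then show ?case by (intro exI[of _ "gate_value us g # ws"]) simp
qed simp

lemma length_slp_values [simp]: "length (slp_values c) = length c"
  using foldl_snoc_gate_value[of "[]" c] by (auto simp: slp_values_def)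

text \<open>Evaluation only appends values, so later gates cannot alter those of a prefix.\<close>

lemma take_slp_values: "take k (slp_values c) = slp_values (take k c)"
proof (cases "k \<le> length c")
  case True
  have "slp_values c = foldl (\<lambda>vs g. vs @ [gate_value vs g]) (slp_values (take k c)) (drop k c)"
    unfolding slp_values_def foldl_append[symmetric] by simp
  then obtain ws where "slp_values c = slp_values (take k c) @ ws"
    using foldl_snoc_gate_value by metis
  then show ?thesis using True by simp
qed simp

lemma nth_slp_values:
  assumes "wf_slp c" "k < length c"
  shows "slp_values c ! k = gate_value (slp_values c) (c ! k)"
proof -
  have "slp_values c ! k = slp_values (take (Suc k) c) ! k"
    by (simp flip: take_slp_values)
  also have "slp_values (take (Suc k) c) =
      slp_values (take k c) @ [gate_value (slp_values (take k c)) (c ! k)]"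
    using assms(2) by (simp add: slp_values_def take_Suc_conv_app_nth)
  also have "\<dots> ! k = gate_value (take k (slp_values c)) (c ! k)"
    using assms(2) by (simp add: nth_append take_slp_values)
  \<comment> \<open>The arguments of gate \<open>k\<close> lie below \<open>k\<close>, where the
    truncated list agrees with the full one.\<close>
  also have "\<dots> = gate_value (slp_values c) (c ! k)"
    using gate_args_less(1)[OF assms] by (cases "c ! k") auto
  finally show ?thesis .
qed

section \<open>Fixed point equations under a policy\<close>

lemma is_LFP_LFP:
  assumes "wf_opt_system S" "is_policy S \<sigma>"
  shows "is_LFP (policy_system S \<sigma>) (LFP (policy_system S \<sigma>))"
  unfolding LFP_def
proof (rule theI', rule LFP_exists)
  show "\<forall>q\<in>set (policy_system S \<sigma>). prob_polynomial (length (policy_system S \<sigma>)) q"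
  proof
    fix q assume "q \<in> set (policy_system S \<sigma>)"
    then obtain v where "v < length S" "q = S ! v ! (\<sigma> ! v)"
      using assms(2) by (auto simp: policy_system_def is_policy_def set_zip)
    moreover from this have "q \<in> set (S ! v)" "S ! v \<in> set S"
      using assms(2) by (auto simp: is_policy_def)
    ultimately have "prob_polynomial (length S) q"
      using assms(1) unfolding wf_opt_system_def by blast
    then show "prob_polynomial (length (policy_system S \<sigma>)) q"
      using assms(2) by (simp add: policy_system_def is_policy_def)
  qed
qed

text \<open>For \<open>slp_system\<close>, where gates refer to earlier gates only, these coordinate
  equations can be solved one gate after the other.\<close>

lemma nth_LFP:
  assumes "wf_opt_system S" "is_policy S \<sigma>" "v < length S"
  shows "LFP (policy_system S \<sigma>) ! v = eval_polynomial (S ! v ! (\<sigma> ! v)) (LFP (policy_system S \<sigma>))"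
proof -
  have "eval_system (policy_system S \<sigma>) (LFP (policy_system S \<sigma>)) = LFP (policy_system S \<sigma>)"
    using is_LFP_LFP[OF assms(1,2)] by (simp add: is_LFP_def)
  from arg_cong[OF this, of "\<lambda>y. y ! v"] show ?thesis
    using assms(2,3) by (simp add: eval_system_def policy_system_def is_policy_def)
qed

lemma length_LFP:
  "wf_opt_system S \<Longrightarrow> is_policy S \<sigma> \<Longrightarrow> length (LFP (policy_system S \<sigma>)) = length S"
  using is_LFP_LFP[of S \<sigma>]
  by (auto simp: is_LFP_def unit_cube_def policy_system_def is_policy_def)

lemma eval_polynomial_append [simp]:
  "eval_polynomial (p @ q) x = eval_polynomial p x + eval_polynomial q x"
  by (simp add: eval_polynomial_def)

lemma eval_polynomial_Nil [simp]: "eval_polynomial [] x = 0"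
  by (simp add: eval_polynomial_def)

text \<open>By \<open>product_below\<close>, every monomial of a gate reads only variables of
  earlier gates with a tag below 15.\<close>

lemma eval_gate_block_cong:
  assumes "gate_args g \<subseteq> {..<k}" "qs \<in> set (gate_block g)" "q \<in> set qs"
    and eq: "\<And>i t. i < k \<Longrightarrow> t < 15 \<Longrightarrow> x ! (16 * i + t) = y ! (16 * i + t)"
  shows "eval_polynomial q x = eval_polynomial q y"
proof -
  have "eval_monomial m x = eval_monomial m y" if "product_below k m" for m
    using that eq by (auto simp: product_below_def eval_monomial_def)
  then have "eval_monomial (snd r) x = eval_monomial (snd r) y" if "r \<in> set q" for r
    using polynomial_of_gate_block(2)[OF assms(1-3) that] by blast
  then show ?thesis
    unfolding eval_polynomial_def
    by (intro arg_cong[of _ _ sum_list] map_cong refl) (simp add: case_prod_beta)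
qed

locale slp_policy =
  fixes c :: slp and \<sigma> :: policy and x :: "real list"
  assumes wf: "wf_slp c" and policy: "is_policy (slp_system c) \<sigma>"
  defines "x \<equiv> LFP (policy_system (slp_system c) \<sigma>)"
begin

lemma length_x: "length x = 16 * length c"
  unfolding x_def using length_LFP[OF wf_slp_system[OF wf] policy] by simp

lemma nth_x:
  assumes "k < length c" "t < 16"
  shows "x ! (16 * k + t) = eval_polynomial (gate_block (c ! k) ! t ! (\<sigma> ! (16 * k + t))) x"
  using nth_LFP[OF wf_slp_system[OF wf] policy, of "16 * k + t"] assms
  by (simp add: nth_slp_system x_def)

lemma policy_less:
  assumes "k < length c" "t < 16"
  shows "\<sigma> ! (16 * k + t) < (if t = 15 then 2 else 1)"
proof -
  have "16 * k + t < 16 * length c" using assms by simp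
  then have "\<sigma> ! (16 * k + t) < length (slp_system c ! (16 * k + t))"
    using policy by (simp add: is_policy_def)
  then show ?thesis using assms by (simp only: nth_slp_system length_nth_gate_block)
qed

lemma nth_x_0:
  assumes "k < length c" "t < 15"
  shows "x ! (16 * k + t) = eval_polynomial (gate_block (c ! k) ! t ! 0) x"
  using nth_x[of k t] policy_less[of k t] assms by simp

lemma copies:
  assumes "k < length c"
  shows "x ! (16 * k + 11) = x ! (16 * k + 8)" "x ! (16 * k + 12) = x ! (16 * k + 9)"
    "x ! (16 * k + 13) = x ! (16 * k + 10)"
proof -
  obtain A B S where "gate_block (c ! k) = block A B S" using gate_block_eq_block by blast
  then show "x ! (16 * k + 11) = x ! (16 * k + 8)" "x ! (16 * k + 12) = x ! (16 * k + 9)"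
    "x ! (16 * k + 13) = x ! (16 * k + 10)"
    using nth_x_0[OF assms] by (simp_all add: nth_block)
qed

text \<open>Strong induction along the circuit: the factor 1/8 is common to \<open>a\<close>,
  \<open>b\<close> and \<open>s\<close>, and \<open>s\<close> is 1/8 or a positive multiple of a
  product of two positive denominators. The claim that the gate has value \<open>(a - b) / s\<close>
  is stated without division.\<close>

lemma value_of_gate:
  "k < length c \<Longrightarrow> x ! (16 * k + 10) > 0 \<and>
    x ! (16 * k + 8) - x ! (16 * k + 9) = of_int (slp_values c ! k) * x ! (16 * k + 10)"
proof (induction k rule: less_induct)
  case (less k)
  \<comment> \<open>The hypothesis is solved for the variable \<open>a\<close> and includes the
    copies, so that rewriting leaves an identity in the variables \<open>b\<close> and
    \<open>s\<close> of the arguments.\<close>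
  have IH: "x ! (16 * i + 10) > 0"
      "x ! (16 * i + 8) = x ! (16 * i + 9) + of_int (slp_values c ! i) * x ! (16 * i + 10)"
      "x ! (16 * i + 11) = x ! (16 * i + 8)" "x ! (16 * i + 12) = x ! (16 * i + 9)"
      "x ! (16 * i + 13) = x ! (16 * i + 10)"
    if "i \<in> gate_args (c ! k)" for i
    using less.IH[of i] less.prems gate_args_less(1)[OF wf less.prems] copies[of i] that by fastforce+
  note eqs = nth_x_0[OF less.prems, of 8] nth_x_0[OF less.prems, of 9] nth_x_0[OF less.prems, of 10]
    nth_slp_values[OF wf less.prems]
  note defs = add_block_def sub_block_def mul_block_def map_block nth_block
    eval_polynomial_def eval_monomial_def of_rat_divide gate_args.simps
  show ?case
  proof (cases "c ! k")
    case Const1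
    then show ?thesis using eqs by (simp add: defs)
  next
    case (Add i j)
    then have IHs: "i \<in> gate_args (c ! k)" "j \<in> gate_args (c ! k)" by auto
    show ?thesis by (simp add: eqs Add IH[OF IHs(1)] IH[OF IHs(2)] defs) (simp add: algebra_simps)?
  next
    case (Sub i j)
    then have IHs: "i \<in> gate_args (c ! k)" "j \<in> gate_args (c ! k)" by auto
    show ?thesis by (simp add: eqs Sub IH[OF IHs(1)] IH[OF IHs(2)] defs) (simp add: algebra_simps)?
  next
    case (Mul i j)
    then have IHs: "i \<in> gate_args (c ! k)" "j \<in> gate_args (c ! k)" by auto
    show ?thesis by (simp add: eqs Mul IH[OF IHs(1)] IH[OF IHs(2)] defs) (simp add: algebra_simps)?
  qed
qed

text \<open>The lists \<open>A\<close>, \<open>B\<close>, \<open>S\<close> are also the polynomials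
  of tags 8, 9, 10, so concatenating them adds up these variables.\<close>

lemma nth_x_choice:
  assumes "k < length c"
  shows "x ! (16 * k + 15) = (if \<sigma> ! (16 * k + 15) = 0 then 2 * x ! (16 * k + 8)
    else 2 * x ! (16 * k + 9) + x ! (16 * k + 10))"
proof -
  obtain A B S where "gate_block (c ! k) = block A B S" using gate_block_eq_block by blast
  moreover have "\<sigma> ! (16 * k + 15) = 0 \<or> \<sigma> ! (16 * k + 15) = 1"
    using policy_less[OF assms, of 15] by auto
  ultimately show ?thesis
    using nth_x_0[OF assms] nth_x[OF assms, of 15] by (auto simp: nth_block)
qed

end

section \<open>Comparison of policies\<close>

lemma LFP_independent:
  assumes "slp_policy c \<sigma>" "slp_policy c \<tau>" "k < length c" "t < 15"
  shows "LFP (policy_system (slp_system c) \<sigma>) ! (16 * k + t) =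
    LFP (policy_system (slp_system c) \<tau>) ! (16 * k + t)"
  using assms(3,4)
proof (induction k arbitrary: t rule: less_induct)
  case (less k)
  have ne: "gate_block (c ! k) ! t \<noteq> []"
    using length_nth_gate_block[of t "c ! k"] less.prems(2) by auto
  have wf: "wf_slp c" using assms(1) by (simp add: slp_policy_def)
  show ?case
    unfolding slp_policy.nth_x_0[OF assms(1) less.prems] slp_policy.nth_x_0[OF assms(2) less.prems]
  \<comment> \<open>Below tag 15 there is a single polynomial, hence the same one under both
    policies, and it reads only variables covered by the induction hypothesis.\<close>
  proof (rule eval_gate_block_cong[OF gate_args_less(1)[OF wf less.prems(1)]])
    show "gate_block (c ! k) ! t \<in> set (gate_block (c ! k))"
      using less.prems(2) by (intro nth_mem) simp
    show "gate_block (c ! k) ! t ! 0 \<in> set (gate_block (c ! k) ! t)"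
      using ne by (intro nth_mem) simp
  qed (use less in auto)
qed

lemma choice_diff:
  assumes "slp_policy c \<sigma>" "slp_policy c \<tau>" "k < length c" "\<sigma> ! (16 * k + 15) = 0"
    "\<tau> ! (16 * k + 15) \<noteq> 0"
  shows "LFP (policy_system (slp_system c) \<tau>) ! (16 * k + 15) <
      LFP (policy_system (slp_system c) \<sigma>) ! (16 * k + 15) \<longleftrightarrow> slp_values c ! k > 0"
    and "LFP (policy_system (slp_system c) \<sigma>) ! (16 * k + 15) <
      LFP (policy_system (slp_system c) \<tau>) ! (16 * k + 15) \<longleftrightarrow> \<not> slp_values c ! k > 0"
proof -
  define s :: real where "s = LFP (policy_system (slp_system c) \<sigma>) ! (16 * k + 10)"
  have s: "s > 0"
    unfolding s_def using slp_policy.value_of_gate[OF assms(1,3)] by blast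
  \<comment> \<open>The alternatives differ by \<open>2 * a - (2 * b + s) = (2 * v - 1) * s\<close>,
    where \<open>v\<close> is the integer value of the gate. The odd factor is never zero and is
    positive exactly for \<open>v > 0\<close>.\<close>
  have eq: "LFP (policy_system (slp_system c) \<sigma>) ! (16 * k + 15) =
    LFP (policy_system (slp_system c) \<tau>) ! (16 * k + 15) + of_int (2 * slp_values c ! k - 1) * s"
    using slp_policy.value_of_gate[OF assms(1,3)] slp_policy.nth_x_choice[OF assms(1,3)]
      slp_policy.nth_x_choice[OF assms(2,3)] LFP_independent[OF assms(1,2,3), of 9]
      LFP_independent[OF assms(1,2,3), of 10] assms(4,5)
    by (simp add: s_def algebra_simps)
  show "LFP (policy_system (slp_system c) \<tau>) ! (16 * k + 15) <
      LFP (policy_system (slp_system c) \<sigma>) ! (16 * k + 15) \<longleftrightarrow> slp_values c ! k > 0"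
    unfolding eq using s by (simp add: zero_less_mult_iff del: of_int_diff of_int_mult) linarith
  show "LFP (policy_system (slp_system c) \<sigma>) ! (16 * k + 15) <
      LFP (policy_system (slp_system c) \<tau>) ! (16 * k + 15) \<longleftrightarrow> \<not> slp_values c ! k > 0"
    unfolding eq using s by (simp add: mult_less_0_iff del: of_int_diff of_int_mult) linarith
qed

lemma choice_eq:
  assumes "slp_policy c \<sigma>" "slp_policy c \<tau>" "k < length c"
    "\<sigma> ! (16 * k + 15) = 0 \<longleftrightarrow> \<tau> ! (16 * k + 15) = 0"
  shows "LFP (policy_system (slp_system c) \<sigma>) ! (16 * k + 15) =
    LFP (policy_system (slp_system c) \<tau>) ! (16 * k + 15)"
  using assms slp_policy.nth_x_choice[OF assms(1,3)] slp_policy.nth_x_choice[OF assms(2,3)]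
    LFP_independent[OF assms(1-3), of 8] LFP_independent[OF assms(1-3), of 9]
    LFP_independent[OF assms(1-3), of 10]
  by simp

text \<open>All coordinates with a tag other than 15 coincide by
  \<open>LFP_independent\<close>.\<close>

lemma vec_le_LFP_iff:
  assumes "slp_policy c \<sigma>" "slp_policy c \<tau>"
  shows "vec_le (LFP (policy_system (slp_system c) \<sigma>)) (LFP (policy_system (slp_system c) \<tau>)) \<longleftrightarrow>
    (\<forall>k < length c. LFP (policy_system (slp_system c) \<sigma>) ! (16 * k + 15) \<le>
      LFP (policy_system (slp_system c) \<tau>) ! (16 * k + 15))"
    (is "vec_le ?x ?y \<longleftrightarrow> ?R")
proof
  assume le: "vec_le ?x ?y"
  show ?R
    using le slp_policy.length_x[OF assms(1)] by (auto simp: list_all2_conv_all_nth)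
next
  assume R: ?R
  have "?x ! v \<le> ?y ! v" if "v < 16 * length c" for v
  proof -
    have v: "v = 16 * (v div 16) + v mod 16" "v div 16 < length c" "v mod 16 < 16"
      using that by auto
    show ?thesis
    proof (cases "v mod 16 = 15")
      case True
      then show ?thesis using R v(1,2) by (metis (no_types))
    next
      case False
      then have "v mod 16 < 15" using v(3) by simp
      from LFP_independent[OF assms v(2) this] show ?thesis by simp
    qed
  qed
  then show "vec_le ?x ?y"
    by (simp add: list_all2_conv_all_nth slp_policy.length_x[OF assms(1)] slp_policy.length_x[OF assms(2)])
qed

text \<open>Serves both as the deviation from a given policy and as the witness that an optimal
  policy exists.\<close>

definition choice_policy :: "slp \<Rightarrow> (nat \<Rightarrow> bool) \<Rightarrow> policy" where
  "choice_policy c Q = map (\<lambda>v. if v mod 16 = 15 \<and> \<not> Q (v div 16) then 1 else 0) [0..<16 * length c]"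

lemma choice_policy:
  assumes "wf_slp c"
  shows "slp_policy c (choice_policy c Q)"
    and "k < length c \<Longrightarrow> choice_policy c Q ! (16 * k + 15) = 0 \<longleftrightarrow> Q k"
proof -
  have "choice_policy c Q ! v < length (slp_system c ! v)" if "v < 16 * length c" for v
  proof -
    have v: "v = 16 * (v div 16) + v mod 16" "v div 16 < length c" "v mod 16 < 16"
      using that by auto
    then have "length (slp_system c ! v) = (if v mod 16 = 15 then 2 else 1)"
      by (metis nth_slp_system length_nth_gate_block)
    then show ?thesis using that by (simp add: choice_policy_def)
  qed
  then show "slp_policy c (choice_policy c Q)"
    using assms by (simp add: slp_policy_def is_policy_def) (simp add: choice_policy_def)
  show "choice_policy c Q ! (16 * k + 15) = 0 \<longleftrightarrow> Q k" if "k < length c"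
    using that by (simp add: choice_policy_def)
qed

text \<open>The choice at one gate affects no other coordinate, so optimality splits into one
  comparison per gate. Since the two alternatives are never equal, each comparison leaves one
  optimal choice.\<close>

lemma optimal_max_iff:
  assumes "wf_slp c"
  shows "optimal_max (slp_system c) \<sigma> \<longleftrightarrow> is_policy (slp_system c) \<sigma> \<and>
    (\<forall>k < length c. \<sigma> ! (16 * k + 15) = 0 \<longleftrightarrow> slp_values c ! k > 0)"
proof (cases "is_policy (slp_system c) \<sigma>")
  case True
  have sp: "slp_policy c \<tau> \<longleftrightarrow> is_policy (slp_system c) \<tau>" for \<tau>
    using assms by (simp add: slp_policy_def)
  have \<sigma>: "slp_policy c \<sigma>" using True sp by blast
  show ?thesis
  proof (rule iffI, rule conjI[OF True], intro allI impI)
    fix k assume opt: "optimal_max (slp_system c) \<sigma>" and k: "k < length c"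
    \<comment> \<open>The policy that reverses every choice of \<open>\<sigma>\<close> tests all
      gates at once.\<close>
    note flip = choice_policy[OF assms, where Q = "\<lambda>k. \<sigma> ! (16 * k + 15) \<noteq> 0"]
    have "\<not> LFP (policy_system (slp_system c) \<sigma>) ! (16 * k + 15) <
      LFP (policy_system (slp_system c) (choice_policy c (\<lambda>k. \<sigma> ! (16 * k + 15) \<noteq> 0))) ! (16 * k + 15)"
      using opt flip(1) k sp vec_le_LFP_iff[OF flip(1) \<sigma>] by (fastforce simp: optimal_max_def)
    then show "\<sigma> ! (16 * k + 15) = 0 \<longleftrightarrow> slp_values c ! k > 0"
      using choice_diff[OF \<sigma> flip(1) k] choice_diff[OF flip(1) \<sigma> k] flip(2)[OF k]
      by (cases "\<sigma> ! (16 * k + 15) = 0") simp_all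
  next
    assume *: "is_policy (slp_system c) \<sigma> \<and>
      (\<forall>k < length c. \<sigma> ! (16 * k + 15) = 0 \<longleftrightarrow> slp_values c ! k > 0)"
    show "optimal_max (slp_system c) \<sigma>"
      unfolding optimal_max_def
    proof (intro conjI allI impI True)
      fix \<tau> assume "is_policy (slp_system c) \<tau>"
      then have \<tau>: "slp_policy c \<tau>" using sp by blast
      show "vec_le (LFP (policy_system (slp_system c) \<tau>)) (LFP (policy_system (slp_system c) \<sigma>))"
        unfolding vec_le_LFP_iff[OF \<tau> \<sigma>]
        using * choice_diff[OF \<sigma> \<tau>] choice_diff[OF \<tau> \<sigma>] choice_eq[OF \<tau> \<sigma>]
        by (metis order_le_less)
    qed
  qed
qed (simp add: optimal_max_def)

text \<open>Minimization reverses each comparison; as ties do not occur, it selects exactly the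
  other alternative.\<close>

lemma optimal_min_iff:
  assumes "wf_slp c"
  shows "optimal_min (slp_system c) \<sigma> \<longleftrightarrow> is_policy (slp_system c) \<sigma> \<and>
    (\<forall>k < length c. \<sigma> ! (16 * k + 15) = 0 \<longleftrightarrow> \<not> slp_values c ! k > 0)"
proof (cases "is_policy (slp_system c) \<sigma>")
  case True
  have sp: "slp_policy c \<tau> \<longleftrightarrow> is_policy (slp_system c) \<tau>" for \<tau>
    using assms by (simp add: slp_policy_def)
  have \<sigma>: "slp_policy c \<sigma>" using True sp by blast
  show ?thesis
  proof (rule iffI, rule conjI[OF True], intro allI impI)
    fix k assume opt: "optimal_min (slp_system c) \<sigma>" and k: "k < length c"
    note flip = choice_policy[OF assms, where Q = "\<lambda>k. \<sigma> ! (16 * k + 15) \<noteq> 0"]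
    have "\<not> LFP (policy_system (slp_system c) (choice_policy c (\<lambda>k. \<sigma> ! (16 * k + 15) \<noteq> 0))) ! (16 * k + 15)
      < LFP (policy_system (slp_system c) \<sigma>) ! (16 * k + 15)"
      using opt flip(1) k sp vec_le_LFP_iff[OF \<sigma> flip(1)] by (fastforce simp: optimal_min_def)
    then show "\<sigma> ! (16 * k + 15) = 0 \<longleftrightarrow> \<not> slp_values c ! k > 0"
      using choice_diff[OF \<sigma> flip(1) k] choice_diff[OF flip(1) \<sigma> k] flip(2)[OF k]
      by (cases "\<sigma> ! (16 * k + 15) = 0") simp_all
  next
    assume *: "is_policy (slp_system c) \<sigma> \<and>
      (\<forall>k < length c. \<sigma> ! (16 * k + 15) = 0 \<longleftrightarrow> \<not> slp_values c ! k > 0)"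
    show "optimal_min (slp_system c) \<sigma>"
      unfolding optimal_min_def
    proof (intro conjI allI impI True)
      fix \<tau> assume "is_policy (slp_system c) \<tau>"
      then have \<tau>: "slp_policy c \<tau>" using sp by blast
      show "vec_le (LFP (policy_system (slp_system c) \<sigma>)) (LFP (policy_system (slp_system c) \<tau>))"
        unfolding vec_le_LFP_iff[OF \<sigma> \<tau>]
        using * choice_diff[OF \<sigma> \<tau>] choice_diff[OF \<tau> \<sigma>] choice_eq[OF \<tau> \<sigma>]
        by (metis order_le_less)
    qed
  qed
qed (simp add: optimal_min_def)


section \<open>Writing the system\<close>

lemma run_copy:
  "set b \<subseteq> {Zero, One} \<Longrightarrow>
    run P (length b + 1) (Copy # is, l, b @ Close # r, out) (is, rev b @ l, Close # r, out @ b)"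
proof (induction b arbitrary: l out)
  case Nil
  then show ?case by (simp add: run.copy_end run.stop)
next
  case (Cons a b)
  then show ?case
    using Cons.IH[of "a # l" "out @ [a]"] by (auto intro: run.copy)
qed

lemma run_seek_right:
  "(\<And>x. x \<in> set u \<Longrightarrow> Some x \<noteq> a) \<Longrightarrow> read r = a \<Longrightarrow>
    run P (length u + 1) (SeekRight a # is, l, u @ r, out) (is, rev u @ l, r, out)"
proof (induction u arbitrary: l)
  case Nil
  then show ?case by (simp add: run.seek_right_end run.stop)
next
  case (Cons x u)
  then show ?case
    using Cons.IH[of "x # l"] by (auto intro: run.seek_right)
qed

text \<open>The time consists of \<open>length v + 1\<close> moves and one step that recognizes
  \<open>b\<close>. If the head started on \<open>b\<close>, the search would end there at
  once.\<close>

lemma run_seek_left: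
  "b \<notin> set v \<Longrightarrow> read r \<noteq> Some b \<Longrightarrow>
    run P (length v + 2) (SeekLeft b # is, v @ b # l, r, out) (is, l, b # rev v @ r, out)"
proof (induction v arbitrary: r)
  case Nil
  then show ?case by (simp add: run.seek_left run.seek_left_end run.stop)
next
  case (Cons a v)
  then show ?case
    using Cons.IH[of "a # r"] by (auto intro: run.seek_left)
qed

text \<open>Here \<open>B\<close> bounds the time spent on one instruction.\<close>

definition emits :: "program \<Rightarrow> nat \<Rightarrow> word \<Rightarrow> word \<Rightarrow> instr list \<Rightarrow> word \<Rightarrow> bool" where
  "emits P B l r is v \<longleftrightarrow>
    (\<forall>js out. run P (length is * B) (is @ js, l, r, out) (js, l, r, out @ v))"

lemma emits_append: "emits P B l r is v \<Longrightarrow> emits P B l r js w \<Longrightarrow> emits P B l r (is @ js) (v @ w)"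
  unfolding emits_def length_append add_mult_distrib
proof (intro allI)
  fix ks out
  assume "\<forall>js out. run P (length is * B) (is @ js, l, r, out) (js, l, r, out @ v)"
    "\<forall>ks out. run P (length js * B) (js @ ks, l, r, out) (ks, l, r, out @ w)"
  then have "run P (length is * B) (is @ js @ ks, l, r, out) (js @ ks, l, r, out @ v)"
    "run P (length js * B) (js @ ks, l, r, out @ v) (ks, l, r, (out @ v) @ w)"
    by blast+
  from run_trans[OF this]
  show "run P (length is * B + length js * B) ((is @ js) @ ks, l, r, out) (ks, l, r, out @ v @ w)"
    by simp
qed

lemma emits_Nil: "emits P B l r [] []"
  by (simp add: emits_def run.stop)

lemma emits_letters:
  assumes "B \<ge> 1"
  shows "emits P B l r (map Emit u) u"
proof (induction u)
  case (Cons a u)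
  have "emits P B l r [Emit a] [a]"
    using assms by (cases B) (auto simp: emits_def intro!: run.emit run.stop)
  then show ?case using emits_append Cons by fastforce
qed (simp add: emits_Nil)

lemma emits_concat:
  "(\<And>x. x \<in> set xs \<Longrightarrow> emits P B l r (f x) (e x)) \<Longrightarrow>
    emits P B l r (concat (map f xs)) (concat (map e xs))"
  by (induction xs) (auto intro: emits_Nil emits_append)

definition list_code :: "('a \<Rightarrow> instr list) \<Rightarrow> 'a list \<Rightarrow> instr list" where
  "list_code f xs = map Emit [Open] @ concat (map f xs) @ map Emit [Close]"

text \<open>The code follows a pattern \<open>xs\<close> fixed in the program, while
  \<open>h\<close> inserts the data of the input; it will be built from
  \<open>gate_term i j\<close>.\<close>

lemma emits_list_code:
  assumes "B \<ge> 1" "\<And>x. x \<in> set xs \<Longrightarrow> emits P B l r (f x) (e (h x))"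
  shows "emits P B l r (list_code f xs) (enc_list e (map h xs))"
proof -
  have "enc_list e (map h xs) = [Open] @ concat (map (\<lambda>x. e (h x)) xs) @ [Close]"
    by (simp add: enc_list_def bracket_def comp_def)
  then show ?thesis
    unfolding list_code_def using assms
    by (auto intro!: emits_append emits_letters emits_concat simp del: list.map append.simps)
qed

section \<open>Binary notation of variable indices\<close>

lemma set_bits: "set (bits n) \<subseteq> {Zero, One}"
proof (induction n rule: bits.induct)
  case (1 n)
  then show ?case by (subst bits.simps) auto
qed

lemma bits_rec: "a < 2 \<Longrightarrow> 0 < m \<or> a = 1 \<Longrightarrow> bits (2 * m + a) = (if a = 1 then One else Zero) # bits m"
  by (subst bits.simps) (auto dest!: less_2_cases)

text \<open>A number from 8 to 15 has exactly four bits, and low bits come first. Its top bit is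
  \<open>One\<close>, so the identity also holds for \<open>n = 0\<close>, where
  \<open>bits n\<close> is empty.\<close>

lemma bits_prefix:
  assumes "8 \<le> t" "t < 16"
  shows "bits (16 * n + t) = bits t @ bits n"
proof -
  define d e f where "d = t div 4 mod 2" "e = t div 2 mod 2" "f = t mod 2"
  have def: "d < 2" "e < 2" "f < 2" by (simp_all add: d_e_f_def)
  \<comment> \<open>Horner form of \<open>16 * m + t\<close>: the low bits of \<open>t\<close> are
    \<open>f\<close>, \<open>e\<close>, \<open>d\<close>, and the fourth one is 1 because of
    \<open>8 \<le> t\<close>.\<close>
  define b where "b m = 2 * (2 * (2 * (2 * m + 1) + d) + e) + f" for m
  let ?c = "\<lambda>a. if a = 1 then One else Zero"
  have chain: "bits (b m) = ?c f # ?c e # ?c d # One # bits m" for m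
  proof -
    have "bits (b m) = ?c f # bits (2 * (2 * (2 * m + 1) + d) + e)"
      unfolding b_def using def by (intro bits_rec) auto
    also have "bits (2 * (2 * (2 * m + 1) + d) + e) = ?c e # bits (2 * (2 * m + 1) + d)"
      using def by (intro bits_rec) auto
    also have "bits (2 * (2 * m + 1) + d) = ?c d # bits (2 * m + 1)"
      using def by (intro bits_rec) auto
    also have "bits (2 * m + 1) = One # bits m"
      using bits_rec[of 1 m] by simp
    finally show ?thesis .
  qed
  have "t = b 0"
  proof -
    have "t \<in> {8, 9, 10, 11, 12, 13, 14, 15}"
      using assms by (simp only: insert_iff empty_iff) presburger
    then show ?thesis
      unfolding d_e_f_def b_def by (elim insertE emptyE) simp_all
  qed
  moreover from this have "16 * n + t = b n" by (simp add: b_def)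
  moreover have "bits 0 = []" by (simp add: bits.simps)
  ultimately show ?thesis
    using chain[of n] chain[of 0] by simp
qed

text \<open>Both holes expect the head on the opening bracket of the first argument of a gate, and
  return it there.\<close>

definition hole1 :: "instr list" where
  "hole1 = [GoRight, Copy, SeekLeft Open]"

definition hole2 :: "instr list" where
  "hole2 = [GoRight, SeekRight (Some Close), GoRight, GoRight, Copy, SeekLeft Open, GoLeft, SeekLeft Open]"

lemma emits_hole1:
  assumes "set u \<subseteq> {Zero, One}" "length u + 2 \<le> B"
  shows "emits P B l (Open # u @ Close # r) hole1 u"
proof -
  have u: "Open \<notin> set (rev u)" using assms(1) by auto
  have "run P (1 + (length u + 1) + (length (rev u) + 2))
    (hole1 @ js, l, Open # u @ Close # r, out) (js, l, Open # u @ Close # r, out @ u)" for js out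
  proof (rule run_trans, rule run_trans)
    show "run P 1 (hole1 @ js, l, Open # u @ Close # r, out)
        (Copy # SeekLeft Open # js, Open # l, u @ Close # r, out)"
      unfolding One_nat_def by (simp add: hole1_def run.right run.stop)
    show "run P (length u + 1) (Copy # SeekLeft Open # js, Open # l, u @ Close # r, out)
        (SeekLeft Open # js, rev u @ Open # l, Close # r, out @ u)"
      by (rule run_copy[OF assms(1)])
    show "run P (length (rev u) + 2) (SeekLeft Open # js, rev u @ Open # l, Close # r, out @ u)
        (js, l, Open # u @ Close # r, out @ u)"
      using run_seek_left[OF u, of "Close # r" P js l "out @ u"] by simp
  qed
  then show ?thesis
    unfolding emits_def by (intro allI, rule run_mono) (use assms in \<open>simp add: hole1_def\<close>)
qed

lemma emits_hole2:
  assumes "set u \<subseteq> {Zero, One}" "set v \<subseteq> {Zero, One}" "length u + length v + 4 \<le> B"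
  shows "emits P B l (Open # u @ Close # Open # v @ Close # r) hole2 v"
proof -
  have u: "Open \<notin> set (rev u)" "\<And>x. x \<in> set u \<Longrightarrow> Some x \<noteq> Some Close" and v: "Open \<notin> set (rev v)"
    using assms(1,2) by auto
  let ?r = "Open # u @ Close # Open # v @ Close # r"
  let ?is6 = "\<lambda>js. SeekLeft Open # GoLeft # SeekLeft Open # js"
  have "run P (1 + (length u + 1) + 2 + (length v + 1) + (length (rev v) + 2) + 1 + (length (rev u) + 2))
    (hole2 @ js, l, ?r, out) (js, l, ?r, out @ v)" for js out
  proof (rule run_trans, rule run_trans, rule run_trans, rule run_trans, rule run_trans, rule run_trans)
    show "run P 1 (hole2 @ js, l, ?r, out)
        (SeekRight (Some Close) # GoRight # GoRight # Copy # ?is6 js, Open # l,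
          u @ Close # Open # v @ Close # r, out)"
      unfolding One_nat_def by (simp add: hole2_def run.right run.stop)
    show "run P (length u + 1) (SeekRight (Some Close) # GoRight # GoRight # Copy # ?is6 js, Open # l,
          u @ Close # Open # v @ Close # r, out)
        (GoRight # GoRight # Copy # ?is6 js, rev u @ Open # l, Close # Open # v @ Close # r, out)"
      by (rule run_seek_right[OF u(2)]) auto
    show "run P 2 (GoRight # GoRight # Copy # ?is6 js, rev u @ Open # l, Close # Open # v @ Close # r, out)
        (Copy # ?is6 js, Open # Close # rev u @ Open # l, v @ Close # r, out)"
      unfolding numeral_2_eq_2 by (simp add: run.right run.stop)
    show "run P (length v + 1) (Copy # ?is6 js, Open # Close # rev u @ Open # l, v @ Close # r, out)
        (?is6 js, rev v @ Open # Close # rev u @ Open # l, Close # r, out @ v)"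
      by (rule run_copy[OF assms(2)])
    show "run P (length (rev v) + 2) (?is6 js, rev v @ Open # Close # rev u @ Open # l, Close # r, out @ v)
        (GoLeft # SeekLeft Open # js, Close # rev u @ Open # l, Open # v @ Close # r, out @ v)"
      using run_seek_left[OF v, of "Close # r" P _ _ "out @ v"] by simp
    \<comment> \<open>This move leaves the bracket of the second argument, on which the next search
      for \<open>Open\<close> would stop immediately.\<close>
    show "run P 1 (GoLeft # SeekLeft Open # js, Close # rev u @ Open # l, Open # v @ Close # r, out @ v)
        (SeekLeft Open # js, rev u @ Open # l, Close # Open # v @ Close # r, out @ v)"
      unfolding One_nat_def by (simp add: run.left run.stop)
    show "run P (length (rev u) + 2)
        (SeekLeft Open # js, rev u @ Open # l, Close # Open # v @ Close # r, out @ v) (js, l, ?r, out @ v)"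
      using run_seek_left[OF u(1), of "Close # Open # v @ Close # r" P js l "out @ v"] by simp
  qed
  then show ?thesis
    unfolding emits_def by (intro allI, rule run_mono) (use assms in \<open>simp add: hole2_def\<close>)
qed

definition var_code :: "instr list \<Rightarrow> nat \<Rightarrow> instr list" where
  "var_code hole t = map Emit (Open # bits t) @ hole @ map Emit [Close]"

lemma emits_var_code:
  assumes "B \<ge> 1" "8 \<le> t" "t < 16" "emits P B l r hole (bits i)"
  shows "emits P B l r (var_code hole t) (enc_nat (16 * i + t))"
proof -
  have eq: "enc_nat (16 * i + t) = (Open # bits t) @ bits i @ [Close]"
    by (simp add: enc_nat_def bracket_def bits_prefix[OF assms(2,3)])
  show ?thesis
    unfolding var_code_def eq by (intro emits_append emits_letters assms)
qed

abbreviation enc_term :: "rat \<times> monomial \<Rightarrow> word" where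
  "enc_term \<equiv> enc_pair enc_rat (enc_list (enc_pair enc_nat enc_nat))"

text \<open>Of the three final brackets the first ends the pair, the second the monomial and the
  third the term.\<close>

fun term_code :: "nat \<times> nat \<Rightarrow> instr list" where
  "term_code (t, t') = map Emit (Open # enc_rat (1/8) @ [Open, Open]) @ var_code hole1 t @
    map Emit (enc_nat 1 @ [Close, Open]) @ var_code hole2 t' @
    map Emit (enc_nat 1 @ [Close, Close, Close])"

text \<open>No outer brackets are written, as the blocks of all gates form a single list.\<close>

definition block_code :: "(nat \<times> nat) list list list \<Rightarrow> instr list" where
  "block_code bl = concat (map (list_code (list_code term_code)) bl)"

lemma emits_block_code:
  assumes "\<And>t t'. (t, t') \<in> set (concat (concat bl)) \<Longrightarrow> 8 \<le> t \<and> t < 16 \<and> 8 \<le> t' \<and> t' < 16"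
  shows "emits P (length (bits i) + length (bits j) + 4) l (enc_nat i @ enc_nat j @ r) (block_code bl)
    (concat (map (enc_list (enc_list enc_term)) (map (map (map (gate_term i j))) bl)))"
proof -
  let ?B = "length (bits i) + length (bits j) + 4"
  let ?r = "enc_nat i @ enc_nat j @ r"
  have holes: "emits P ?B l ?r hole1 (bits i)" "emits P ?B l ?r hole2 (bits j)"
    using emits_hole1[OF set_bits[of i]] emits_hole2[OF set_bits[of i] set_bits[of j]]
    by (simp_all add: enc_nat_def bracket_def)
  have "emits P ?B l ?r (term_code (t, t')) (enc_term (gate_term i j (t, t')))"
    if "8 \<le> t" "t < 16" "8 \<le> t'" "t' < 16" for t t'
  proof -
    have eq: "enc_term (gate_term i j (t, t')) = (Open # enc_rat (1/8) @ [Open, Open]) @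
      enc_nat (16 * i + t) @ (enc_nat 1 @ [Close, Open]) @ enc_nat (16 * j + t') @
      (enc_nat 1 @ [Close, Close, Close])"
      by (simp add: bracket_def enc_list_def)
    show ?thesis
      unfolding eq term_code.simps using that holes
      by (intro emits_append emits_letters emits_var_code) auto
  qed
  then have "emits P ?B l ?r (term_code x) (enc_term (gate_term i j x))" if "x \<in> set (concat (concat bl))" for x
    using assms that by (cases x) blast
  then have "emits P ?B l ?r (list_code (list_code term_code) vs)
      (enc_list (enc_list enc_term) (map (map (gate_term i j)) vs))" if "vs \<in> set bl" for vs
    using that by (intro emits_list_code) auto
  then show ?thesis
    unfolding block_code_def map_map comp_def by (rule emits_concat)
qed

section \<open>The transducer for straight-line programs\<close>

definition next_gate :: "letter option \<Rightarrow> nat" where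
  "next_gate a = (if a = Some Open then 2 else 1)"

text \<open>Started on the first argument; the last two moves pass the closing brackets of the
  second argument and of the gate.\<close>

definition leave_gate :: "instr list" where
  "leave_gate = [SeekRight (Some Close), GoRight, SeekRight (Some Close), GoRight, GoRight, Case next_gate]"

definition enc_block :: "polynomial list list \<Rightarrow> word" where
  "enc_block = (\<lambda>bl. concat (map (enc_list (enc_list enc_term)) bl))"

text \<open>Piece 0 treats the opening bracket of the list and piece 1 its closing bracket. Pieces 2
  to 4 decode the two tag letters of a gate; pieces 5 to 8 write the block of \<open>Const1\<close>,
  \<open>Add\<close>, \<open>Sub\<close> and \<open>Mul\<close>. \<open>next_gate\<close> returns to
  piece 2 while another gate follows.\<close>

definition slp_program :: program where
  "slp_program = [
    [Emit Open, GoRight, Case next_gate],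
    [Emit Close],
    [GoRight, Case (\<lambda>a. if a = Some Zero then 3 else 4)],
    [GoRight, Case (\<lambda>a. if a = Some Zero then 5 else 6)],
    [GoRight, Case (\<lambda>a. if a = Some Zero then 7 else 8)],
    map Emit (enc_block (gate_block Const1)) @ [GoRight, GoRight, Case next_gate],
    GoRight # block_code add_block @ leave_gate,
    GoRight # block_code sub_block @ leave_gate,
    GoRight # block_code mul_block @ leave_gate]"

lemma code_slp_program:
  "code slp_program 0 = [Emit Open, GoRight, Case next_gate]"
  "code slp_program (Suc 0) = [Emit Close]"
  "code slp_program 2 = [GoRight, Case (\<lambda>a. if a = Some Zero then 3 else 4)]"
  "code slp_program 3 = [GoRight, Case (\<lambda>a. if a = Some Zero then 5 else 6)]"
  "code slp_program 4 = [GoRight, Case (\<lambda>a. if a = Some Zero then 7 else 8)]"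
  "code slp_program 5 = map Emit (enc_block (gate_block Const1)) @ [GoRight, GoRight, Case next_gate]"
  "code slp_program 6 = GoRight # block_code add_block @ leave_gate"
  "code slp_program 7 = GoRight # block_code sub_block @ leave_gate"
  "code slp_program 8 = GoRight # block_code mul_block @ leave_gate"
  by (simp_all add: code_def slp_program_def)

lemma run_leave_gate:
  "run P (length (bits i) + length (bits j) + 8) (leave_gate, l, enc_nat i @ enc_nat j @ Close # r, out)
    (code P (next_gate (read r)), Close # rev (enc_nat j) @ rev (enc_nat i) @ l, r, out)"
proof -
  have no_close: "Some x \<noteq> Some Close" if "x \<in> set (Open # bits n)" for x n
    using that set_bits[of n] by auto
  have "run P ((length (Open # bits i) + 1) + 1 + (length (Open # bits j) + 1) + 3)
    (leave_gate, l, enc_nat i @ enc_nat j @ Close # r, out)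
    (code P (next_gate (read r)), Close # rev (enc_nat j) @ rev (enc_nat i) @ l, r, out)"
  proof (rule run_trans, rule run_trans, rule run_trans)
    show "run P (length (Open # bits i) + 1) (leave_gate, l, enc_nat i @ enc_nat j @ Close # r, out)
        (tl leave_gate, rev (Open # bits i) @ l, Close # enc_nat j @ Close # r, out)"
      using run_seek_right[of "Open # bits i" "Some Close" "Close # enc_nat j @ Close # r" P "tl leave_gate" l out]
        no_close[of _ i] by (simp add: leave_gate_def enc_nat_def bracket_def)
    show "run P 1 (tl leave_gate, rev (Open # bits i) @ l, Close # enc_nat j @ Close # r, out)
        (tl (tl leave_gate), rev (enc_nat i) @ l, enc_nat j @ Close # r, out)"
      unfolding One_nat_def by (simp add: leave_gate_def enc_nat_def[of i] bracket_def run.right run.stop)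
    show "run P (length (Open # bits j) + 1) (tl (tl leave_gate), rev (enc_nat i) @ l, enc_nat j @ Close # r, out)
        (tl (tl (tl leave_gate)), rev (Open # bits j) @ rev (enc_nat i) @ l, Close # Close # r, out)"
      using run_seek_right[of "Open # bits j" "Some Close" "Close # Close # r" P
          "tl (tl (tl leave_gate))" "rev (enc_nat i) @ l" out]
        no_close[of _ j] by (simp add: leave_gate_def enc_nat_def[of j] bracket_def)
    show "run P 3 (tl (tl (tl leave_gate)), rev (Open # bits j) @ rev (enc_nat i) @ l, Close # Close # r, out)
        (code P (next_gate (read r)), Close # rev (enc_nat j) @ rev (enc_nat i) @ l, r, out)"
      unfolding numeral_3_eq_3
      by (simp add: leave_gate_def enc_nat_def[of j] bracket_def run.right run.branch run.stop)
  qed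
  then show ?thesis by (simp add: add.commute add.left_commute)
qed

text \<open>A bound on the steps per letter of a gate: the number of instructions is fixed, and each
  takes time linear in the word of the gate.\<close>

definition slp_time :: nat where
  "slp_time = 20 + length (enc_block (gate_block Const1)) + length (block_code add_block) +
    length (block_code sub_block) + length (block_code mul_block)"

text \<open>The 4 steps subtracted have been spent on decoding the tag letters; the 4 letters added
  to the arguments are these tag letters and the brackets of the gate.\<close>

lemma run_binary_gate:
  assumes "code P m = GoRight # block_code bl @ leave_gate"
    and "\<And>t t'. (t, t') \<in> set (concat (concat bl)) \<Longrightarrow> 8 \<le> t \<and> t < 16 \<and> 8 \<le> t' \<and> t' < 16"
    and "length (block_code bl) + 20 \<le> K" "length w = length (enc_nat i @ enc_nat j) + 4"
  shows "run P (K * length w - 4) (code P m, l, a # enc_nat i @ enc_nat j @ Close # r, out)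
    (code P (next_gate (read r)), Close # rev (enc_nat j) @ rev (enc_nat i) @ a # l, r,
      out @ enc_block (map (map (map (gate_term i j))) bl))"
proof -
  let ?b = "length (bits i) + length (bits j)"
  let ?out = "out @ enc_block (map (map (map (gate_term i j))) bl)"
  have "run P (1 + length (block_code bl) * (?b + 4) + (?b + 8))
    (code P m, l, a # enc_nat i @ enc_nat j @ Close # r, out)
    (code P (next_gate (read r)), Close # rev (enc_nat j) @ rev (enc_nat i) @ a # l, r, ?out)"
  proof (rule run_trans, rule run_trans)
    show "run P 1 (code P m, l, a # enc_nat i @ enc_nat j @ Close # r, out)
        (block_code bl @ leave_gate, a # l, enc_nat i @ enc_nat j @ Close # r, out)"
      unfolding One_nat_def by (simp add: assms(1) run.right run.stop)
    show "run P (length (block_code bl) * (?b + 4))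
        (block_code bl @ leave_gate, a # l, enc_nat i @ enc_nat j @ Close # r, out)
        (leave_gate, a # l, enc_nat i @ enc_nat j @ Close # r, ?out)"
      using emits_block_code[OF assms(2)] unfolding emits_def enc_block_def by blast
    show "run P (?b + 8) (leave_gate, a # l, enc_nat i @ enc_nat j @ Close # r, ?out)
        (code P (next_gate (read r)), Close # rev (enc_nat j) @ rev (enc_nat i) @ a # l, r, ?out)"
      by (rule run_leave_gate)
  qed
  moreover have "1 + length (block_code bl) * (?b + 4) + (?b + 8) \<le> K * length w - 4"
  proof -
    have w: "length w = ?b + 8" using assms(4) by (simp add: enc_nat_def bracket_def)
    have "(length (block_code bl) + 20) * (?b + 8) \<le> K * length w"
      unfolding w using assms(3) by (rule mult_right_mono) simp
    then show ?thesis by (simp add: algebra_simps)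
  qed
  ultimately show ?thesis by (rule run_mono)
qed

lemma run_gate:
  "run slp_program (slp_time * length (enc_gate g)) (code slp_program 2, l, enc_gate g @ r, out)
    (code slp_program (next_gate (read r)), rev (enc_gate g) @ l, r, out @ enc_block (gate_block g))"
proof (cases "\<exists>i j. g = Add i j \<or> g = Sub i j \<or> g = Mul i j")
  case True
  then obtain i j m a b bl where g: "gate_block g = map (map (map (gate_term i j))) bl"
      "enc_gate g = Open # a # b # enc_nat i @ enc_nat j @ [Close]"
    and m: "code slp_program m = GoRight # block_code bl @ leave_gate"
      "m = (if a = Zero then if b = Zero then 5 else 6 else if b = Zero then 7 else 8)"
    and bl: "bl = add_block \<or> bl = sub_block \<or> bl = mul_block"
    using code_slp_program(7-9) by (elim exE disjE) (fastforce simp: bracket_def)+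
  have tags: "8 \<le> t \<and> t < 16 \<and> 8 \<le> t' \<and> t' < 16" if "(t, t') \<in> set (concat (concat bl))" for t t'
    using bl that by (auto simp: add_block_def sub_block_def mul_block_def block_def)
  have K: "length (block_code bl) + 20 \<le> slp_time"
    using bl by (auto simp: slp_time_def)
  have "run slp_program (Suc (Suc (Suc (Suc 0)))) (code slp_program 2, l, enc_gate g @ r, out)
      (code slp_program m, a # Open # l, b # enc_nat i @ enc_nat j @ Close # r, out)"
    by (simp add: g m(2) code_slp_program run.right run.branch run.stop)
  moreover have "run slp_program (slp_time * length (enc_gate g) - 4)
      (code slp_program m, a # Open # l, b # enc_nat i @ enc_nat j @ Close # r, out)
      (code slp_program (next_gate (read r)), rev (enc_gate g) @ l, r, out @ enc_block (gate_block g))"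
    using run_binary_gate[OF m(1) tags K, of "enc_gate g" i j "a # Open # l" b r out]
    by (simp add: g)
  ultimately have "run slp_program (Suc (Suc (Suc (Suc 0))) + (slp_time * length (enc_gate g) - 4))
      (code slp_program 2, l, enc_gate g @ r, out)
      (code slp_program (next_gate (read r)), rev (enc_gate g) @ l, r, out @ enc_block (gate_block g))"
    by (rule run_trans)
  moreover have "4 \<le> slp_time * length (enc_gate g)"
    by (simp add: g slp_time_def)
  ultimately show ?thesis by (auto elim: run_mono)
next
  case False
  then have g: "g = Const1" by (cases g) auto
  let ?w = "enc_block (gate_block Const1)"
  have "run slp_program (Suc (Suc (Suc (Suc 0))) + length ?w * 1 + Suc (Suc (Suc 0)))
      (code slp_program 2, l, enc_gate g @ r, out)
      (code slp_program (next_gate (read r)), rev (enc_gate g) @ l, r, out @ enc_block (gate_block g))"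
  proof (rule run_trans, rule run_trans)
    show "run slp_program (Suc (Suc (Suc (Suc 0)))) (code slp_program 2, l, enc_gate g @ r, out)
      (code slp_program 5, Zero # Open # l, Zero # Close # r, out)"
      by (simp add: g bracket_def code_slp_program run.right run.branch run.stop)
    show "run slp_program (length ?w * 1) (code slp_program 5, Zero # Open # l, Zero # Close # r, out)
      ([GoRight, GoRight, Case next_gate], Zero # Open # l, Zero # Close # r, out @ ?w)"
      using emits_letters[of 1 slp_program "Zero # Open # l" "Zero # Close # r" ?w]
      by (simp add: emits_def code_slp_program del: gate_block.simps)
    show "run slp_program (Suc (Suc (Suc 0))) ([GoRight, GoRight, Case next_gate], Zero # Open # l, Zero # Close # r, out @ ?w)
      (code slp_program (next_gate (read r)), rev (enc_gate g) @ l, r, out @ enc_block (gate_block g))"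
      by (simp add: g bracket_def run.right run.branch run.stop del: gate_block.simps)
  qed
  moreover have "Suc (Suc (Suc (Suc 0))) + length ?w * 1 + Suc (Suc (Suc 0)) \<le> slp_time * length (enc_gate g)"
    by (simp add: g bracket_def slp_time_def del: gate_block.simps)
  ultimately show ?thesis by (rule run_mono)
qed

text \<open>Stating the start through \<open>next_gate\<close> covers both a further gate and the
  end of the list, so that the runs of single gates compose by induction. The additional step writes
  the final bracket.\<close>

lemma run_gates:
  "run slp_program (slp_time * length (concat (map enc_gate c)) + 1)
    (code slp_program (next_gate (read (concat (map enc_gate c) @ [Close]))), l,
      concat (map enc_gate c) @ [Close], out)
    ([], rev (concat (map enc_gate c)) @ l, [Close], out @ enc_block (slp_system c) @ [Close])"
proof (induction c arbitrary: l out)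
  case Nil
  show ?case
    by (simp add: next_gate_def code_slp_program slp_system_def enc_block_def run.emit run.stop)
next
  case (Cons g c)
  let ?w = "concat (map enc_gate c) @ [Close]"
  have "read (enc_gate g @ ?w) = Some Open" by (cases g) (simp_all add: bracket_def)
  moreover have "run slp_program (slp_time * length (enc_gate g) + (slp_time * length (concat (map enc_gate c)) + 1))
    (code slp_program 2, l, enc_gate g @ ?w, out)
    ([], rev (concat (map enc_gate c)) @ rev (enc_gate g) @ l, [Close],
      (out @ enc_block (gate_block g)) @ enc_block (slp_system c) @ [Close])"
    by (rule run_trans[OF run_gate Cons.IH])
  ultimately show ?case
    by (simp add: next_gate_def slp_system_def enc_block_def algebra_simps)
qed

lemma polytime_slp_system: "polytime_on D (enc_list enc_gate) enc_opt_system slp_system"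
\<comment> \<open>Linear time: the constant 4 accounts for the three steps of piece 0 and the final
  bracket.\<close>
proof (rule polytime_on_program[where P = slp_program and p = "[:4, slp_time:]"])
  show "code slp_program 0 \<noteq> []" by (simp add: code_slp_program)
  fix c :: slp
  let ?w = "concat (map enc_gate c) @ [Close]"
  let ?l = "rev (concat (map enc_gate c)) @ [Open]"
  have "run slp_program (Suc (Suc (Suc 0)) + (slp_time * length (concat (map enc_gate c)) + 1))
    (code slp_program 0, [], enc_list enc_gate c, []) ([], ?l, [Close], [Open] @ enc_block (slp_system c) @ [Close])"
  proof (rule run_trans[OF _ run_gates])
    show "run slp_program (Suc (Suc (Suc 0))) (code slp_program 0, [], enc_list enc_gate c, [])
      (code slp_program (next_gate (read ?w)), [Open], ?w, [Open])"
      by (simp add: code_slp_program enc_list_def bracket_def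
          run.emit run.right run.branch run.stop)
  qed
  then have "run slp_program (poly [:4, slp_time:] (length (enc_list enc_gate c)))
    (code slp_program 0, [], enc_list enc_gate c, []) ([], ?l, [Close], [Open] @ enc_block (slp_system c) @ [Close])"
    by (rule run_mono) (simp add: enc_list_def bracket_def algebra_simps)
  moreover have "[Open] @ enc_block (slp_system c) @ [Close] = enc_opt_system (slp_system c)"
    by (simp add: enc_opt_system_def enc_block_def enc_list_def[of "enc_list _"] bracket_def)
  ultimately show "\<exists>l r. run slp_program (poly [:4, slp_time:] (length (enc_list enc_gate c)))
    (code slp_program 0, [], enc_list enc_gate c, []) ([], l, r, enc_opt_system (slp_system c))"
    by metis
qed

section \<open>Reading off the answer\<close>

text \<open>From the blank behind the input, four moves lead to the letter in front of the last
  three brackets. The answer for a last entry 0 is \<open>b\<close>.\<close>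

definition answer_program :: "bool \<Rightarrow> program" where
  "answer_program b = [
    [SeekRight None, GoLeft, GoLeft, GoLeft, GoLeft, Case (\<lambda>a. if a = Some One then 1 else 2)],
    map Emit (enc_bool (\<not> b)), map Emit (enc_bool b)]"

text \<open>The last number of the list is \<open>0\<close> or \<open>1\<close>, so that the letter in front of the last three
  brackets is \<open>Open\<close> or \<open>One\<close>.\<close>

lemma polytime_last_eq_0:
  assumes "\<And>x y. (x, y) \<in> D \<Longrightarrow> y \<noteq> [] \<and> last y < 2"
  shows "polytime_on D (enc_pair encA (enc_list enc_nat)) enc_bool (\<lambda>(x, y). (last y = 0) = b)"
proof (rule polytime_on_program[where P = "answer_program b" and p = "[:7, 1:]"])
  let ?P = "answer_program b"
  have code: "code ?P 0 = [SeekRight None, GoLeft, GoLeft, GoLeft, GoLeft, Case (\<lambda>a. if a = Some One then 1 else 2)]"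
    "code ?P 1 = map Emit (enc_bool (\<not> b))" "code ?P 2 = map Emit (enc_bool b)"
    by (simp_all add: code_def answer_program_def)
  have enc_bool_eq: "enc_bool x = [if x then One else Zero]" for x
    by (simp add: enc_bool_def)
  show "code ?P 0 \<noteq> []" by (simp add: code)
  fix z assume "z \<in> D"
  then obtain x y where z: "z = (x, y)" "y \<noteq> []" "last y < 2" using assms by (cases z) auto
  then obtain ys k where y: "y = ys @ [k]" "k < 2" by (cases y rule: rev_cases) auto
  let ?w = "enc_pair encA (enc_list enc_nat) z"
  obtain u a where w: "?w = u @ [a, Close, Close, Close]" and a: "a = One \<longleftrightarrow> k \<noteq> 0"
  proof (cases "k = 0")
    case True
    then show thesis
      using that[of "Open # encA x @ Open # concat (map enc_nat ys)" Open]
      by (simp add: z y enc_list_def bracket_def enc_nat_def[of 0] bits.simps)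
  next
    case False
    then have "k = 1" using y by simp
    then show thesis
      using that[of "Open # encA x @ Open # concat (map enc_nat ys) @ [Open]" One]
      by (simp add: z y enc_list_def bracket_def enc_nat_def[of "Suc 0"] bits.simps)
  qed
  have "run ?P (length ?w + 1 + Suc (Suc (Suc (Suc (Suc (Suc 0)))))) (code ?P 0, [], ?w, [])
    ([], rev u, [a, Close, Close, Close], enc_bool ((k = 0) = b))"
  proof (rule run_trans)
    show "run ?P (length ?w + 1) (code ?P 0, [], ?w, []) (tl (code ?P 0), rev ?w, [], [])"
      using run_seek_right[of ?w None "[]" ?P "tl (code ?P 0)" "[]" "[]"] by (simp add: code)
    show "run ?P (Suc (Suc (Suc (Suc (Suc (Suc 0)))))) (tl (code ?P 0), rev ?w, [], [])
        ([], rev u, [a, Close, Close, Close], enc_bool ((k = 0) = b))"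
      using a unfolding w by (cases "k = 0")
        (simp_all add: code[unfolded One_nat_def] enc_bool_eq run.left run.branch run.emit run.stop)
  qed
  then have "run ?P (poly [:7, 1:] (length ?w)) (code ?P 0, [], ?w, [])
      ([], rev u, [a, Close, Close, Close], enc_bool ((k = 0) = b))"
    by (rule run_mono) simp
  then show "\<exists>l r. run ?P (poly [:7, 1:] (length ?w)) (code ?P 0, [], ?w, [])
      ([], l, r, enc_bool (case z of (x, y) \<Rightarrow> (last y = 0) = b))"
    unfolding z(1) y(1) by auto
qed

section \<open>Assembling the reduction\<close>

lemma slp_output_eq:
  assumes "wf_slp c"
  shows "slp_output c = slp_values c ! (length c - 1)"
proof -
  have "slp_values c \<noteq> []" using assms length_slp_values[of c] by (auto simp: wf_slp_def simp del: length_slp_values)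
  then show ?thesis by (simp add: slp_output_def last_conv_nth)
qed

text \<open>Tag 15 comes last in a block and the output gate last in the circuit, so the last entry
  of a policy is the choice at the output gate.\<close>

lemma last_policy:
  assumes "wf_slp c" "is_policy (slp_system c) \<sigma>"
  shows "\<sigma> \<noteq> []" "last \<sigma> < 2" "last \<sigma> = \<sigma> ! (16 * (length c - 1) + 15)"
proof -
  have c: "length c > 0" using assms(1) by (simp add: wf_slp_def)
  have len: "length \<sigma> = 16 * length c" using assms(2) by (simp add: is_policy_def)
  then show ne: "\<sigma> \<noteq> []" using c by auto
  have "length \<sigma> - 1 = 16 * (length c - 1) + 15" using len c by arith
  then show last: "last \<sigma> = \<sigma> ! (16 * (length c - 1) + 15)" using ne by (simp add: last_conv_nth)
  show "last \<sigma> < 2"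
    using slp_policy.policy_less[of c \<sigma> "length c - 1" 15] assms c unfolding last
    by (simp add: slp_policy_def)
qed

text \<open>The parameter \<open>b\<close> treats both problems at once: choice 0 means a positive
  value under maximization, where \<open>b\<close> is \<open>True\<close>, and a nonpositive one
  under minimization.\<close>

lemma polytime_reducible_PosSLP:
  assumes inst: "srch_instances S = {S. wf_opt_system S}" "srch_enc S = enc_opt_system"
      "srch_enc_sol S = enc_list enc_nat"
    and sol: "\<And>c \<sigma>. wf_slp c \<Longrightarrow> srch_solution S (slp_system c) \<sigma> \<longleftrightarrow> is_policy (slp_system c) \<sigma> \<and>
      (\<forall>k < length c. \<sigma> ! (16 * k + 15) = 0 \<longleftrightarrow> (slp_values c ! k > 0) = b)"
  shows "polytime_reducible PosSLP S"
  unfolding polytime_reducible_def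
proof (rule exI[of _ slp_system], rule exI[of _ "\<lambda>(x, y). (last y = 0) = b"], intro conjI ballI allI impI)
  show "polytime_on (dec_instances PosSLP) (dec_enc PosSLP) (srch_enc S) slp_system"
    unfolding inst by (simp add: PosSLP_def polytime_slp_system)
  show "polytime_on {(x, y). x \<in> dec_instances PosSLP \<and> srch_solution S (slp_system x) y}
      (enc_pair (dec_enc PosSLP) (srch_enc_sol S)) enc_bool (\<lambda>(x, y). (last y = 0) = b)"
    unfolding inst by (rule polytime_last_eq_0) (use last_policy(1,2) sol in \<open>force simp: PosSLP_def\<close>)
next
  fix c assume "c \<in> dec_instances PosSLP"
  then have c: "wf_slp c" by (simp add: PosSLP_def)
  show "slp_system c \<in> srch_instances S"
    using wf_slp_system[OF c] by (simp add: inst)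
  \<comment> \<open>The policy that follows the actual signs of all gate values is optimal.\<close>
  show "\<exists>y. srch_solution S (slp_system c) y"
    using choice_policy[OF c, where Q = "\<lambda>k. (slp_values c ! k > 0) = b"]
    by (auto simp: sol[OF c] slp_policy_def)
  fix y assume "srch_solution S (slp_system c) y"
  moreover have "length c > 0" using c by (simp add: wf_slp_def)
  \<comment> \<open>The optimality condition at \<open>k = length c - 1\<close> relates the last
    entry of \<open>y\<close> to the sign of the output.\<close>
  ultimately show "(case (c, y) of (x, y) \<Rightarrow> (last y = 0) = b) \<longleftrightarrow> dec_yes PosSLP c"
    using last_policy(3)[OF c, of y] by (auto simp: sol[OF c] PosSLP_def slp_output_eq[OF c])
qed

theorem theorem4p1:
  shows "polytime_reducible PosSLP OptPolicy_maxPPS \<and> polytime_reducible PosSLP OptPolicy_minPPS"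
proof
  show "polytime_reducible PosSLP OptPolicy_maxPPS"
    by (rule polytime_reducible_PosSLP[where b = True])
      (simp_all add: OptPolicy_maxPPS_def optimal_max_iff)
  show "polytime_reducible PosSLP OptPolicy_minPPS"
    by (rule polytime_reducible_PosSLP[where b = False])
      (simp_all add: OptPolicy_minPPS_def optimal_min_iff)
qed

end
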